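(* For every computable coloring $c:\mathbf{N}\to\{0,1\}$ there exists an infinite apart set $H$ of positive integers such that for some integers $a,b>0$ the set $FS^{\{a,\,b,\,a+b,\,a+2b\}}(H)$ is monochromatic under $c$, and such that $H'\leq_T\emptyset^{(B(2,3,1))}$.
   Context: $\mathbf{N}$ is the set of natural numbers. For a positive integer $n=2^{t_1}+\dots+2^{t_k}$ with $t_1<\dots<t_k$ let $\lambda(n)=t_1$ and $\mu(n)=t_k$. A set $X$ of positive integers is apart (satisfies the Apartness Condition) if for all $x,x'\in X$ with $x<x'$ we have $\mu(x)<\lambda(x')$. For a set $A$ of positive integers and a set $Y\subseteq\mathbf{N}$, $FS^{A}(Y)$ denotes the set of all sums of exactly $j$ distinct elements of $Y$, for all $j\in A$. A set is monochromatic under $c$ if $c$ is constant on it. Brauer's Theorem states that for all $r,\ell,s\geq 1$ there is $n$ such that for every $g:[1,n]\to\{0,\dots,r-1\}$ there exist $a,b>0$ such that $\{a,a+b,\dots,a+(\ell-1)b\}\cup\{sb\}\subseteq[1,n]$ is monochromatic under $g$; $B(r,\ell,s)$ denotes the least such $n$ (the witnessing function of Brauer's Theorem). $H'$ is the Turing jump of $H$, $\emptyset^{(n)}$ is the $n$-th Turing jump of the empty set, and $\leq_T$ is Turing reducibility. *)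

theory Defs
  imports "HOL-Library.Nat_Bijection" "HOL-Library.FuncSet"
begin

text \<open>
  Partial computability relative to an oracle. The libraries contain no relative
  computability, so programs are the \<open>\<mu>\<close>-recursive functions with an additional
  initial function answering membership queries. All functions are unary; several
  arguments are passed through the pairing function \<^const>\<open>prod_encode\<close>, so that
  \<open>OFst\<close>, \<open>OSnd\<close>, \<open>OPair\<close> take the place of projections and tuples.
\<close>

datatype prog =
    OZero
  | OSucc
  | OFst
  | OSnd
  | OQuery
  | OPair prog prog
  | OComp prog prog
  | ORec prog prog
  | OMin prog

text \<open>
  \<open>run X p x\<close> is the result of program \<open>p\<close> with oracle \<open>X\<close> on input \<open>x\<close>, and
  \<^const>\<open>None\<close> if the computation diverges. Composition and primitive recursion are
  strict; minimisation requires all values below the first zero to be defined.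
\<close>

primrec run :: "nat set \<Rightarrow> prog \<Rightarrow> nat \<Rightarrow> nat option" where
  "run X OZero x = Some 0"
| "run X OSucc x = Some (Suc x)"
| "run X OFst x = Some (fst (prod_decode x))"
| "run X OSnd x = Some (snd (prod_decode x))"
| "run X OQuery x = Some (of_bool (x \<in> X))"
| "run X (OPair p q) x =
     Option.bind (run X p x) (\<lambda>u. Option.bind (run X q x) (\<lambda>v. Some (prod_encode (u, v))))"
| "run X (OComp p q) x = Option.bind (run X q x) (run X p)"
| "run X (ORec p q) x =
     (case prod_decode x of (a, n) \<Rightarrow>
       rec_nat (run X p a)
         (\<lambda>m r. Option.bind r (\<lambda>v. run X q (prod_encode (a, prod_encode (m, v))))) n)"
| "run X (OMin p) x =
     (if \<exists>n. run X p (prod_encode (x, n)) = Some 0 \<and>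
             (\<forall>m<n. run X p (prod_encode (x, m)) \<noteq> None)
      then Some (LEAST n. run X p (prod_encode (x, n)) = Some 0)
      else None)"

primrec prog_encode :: "prog \<Rightarrow> nat" where
  "prog_encode OZero = 0"
| "prog_encode OSucc = 1"
| "prog_encode OFst = 2"
| "prog_encode OSnd = 3"
| "prog_encode OQuery = 4"
| "prog_encode (OPair p q) = 5 + 4 * prod_encode (prog_encode p, prog_encode q)"
| "prog_encode (OComp p q) = 6 + 4 * prod_encode (prog_encode p, prog_encode q)"
| "prog_encode (ORec p q) = 7 + 4 * prod_encode (prog_encode p, prog_encode q)"
| "prog_encode (OMin p) = 8 + 4 * prog_encode p"

lemma inj_prog_encode: "inj prog_encode"
proof (rule injI)
  fix p q show "prog_encode p = prog_encode q \<Longrightarrow> p = q"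
  proof (induction p arbitrary: q)
    case OZero then show ?case by (cases q) auto
  next
    case OSucc then show ?case by (cases q) auto
  next
    case OFst then show ?case by (cases q) auto
  next
    case OSnd then show ?case by (cases q) auto
  next
    case OQuery then show ?case by (cases q) auto
  next
    case (OPair p1 p2) from OPair.prems OPair.IH show ?case by (cases q) (auto, presburger+)
  next
    case (OComp p1 p2) from OComp.prems OComp.IH show ?case by (cases q) (auto, presburger+)
  next
    case (ORec p1 p2) from ORec.prems ORec.IH show ?case by (cases q) (auto, presburger+)
  next
    case (OMin p) from OMin.prems OMin.IH show ?case by (cases q) (auto, presburger+)
  qed
qed

lemma surj_prog_encode: "surj prog_encode"
proof -
  have "\<exists>p. prog_encode p = e" for e
  proof (induction e rule: less_induct)
    case (less e)
    show ?case
    proof (cases "e < 5")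
      case True
      then consider "e = 0" | "e = 1" | "e = 2" | "e = 3" | "e = 4" by linarith
      then show ?thesis using prog_encode.simps(1-5) by cases metis+
    next
      case False
      define k where "k = (e - 5) div 4"
      define u v where "u = fst (prod_decode k)" and "v = snd (prod_decode k)"
      have k: "k = prod_encode (u, v)" by (simp add: u_def v_def)
      have "k < e" using False by (simp add: k_def)
      then have "u < e" "v < e"
        using le_prod_encode_1[of u v] le_prod_encode_2[of v u] k by linarith+
      with \<open>k < e\<close> obtain p q r where
        "prog_encode p = u" "prog_encode q = v" "prog_encode r = k"
        using less by meson
      moreover have "e = 5 + 4 * k \<or> e = 6 + 4 * k \<or> e = 7 + 4 * k \<or> e = 8 + 4 * k"
        using False unfolding k_def by presburger
      ultimately show ?thesis
        using prog_encode.simps(6-9) k by metis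
    qed
  qed
  then show ?thesis by (metis surjI)
qed

text \<open>
  Since the numbering is a bijection, \<open>phi X e\<close> is defined for all \<open>e\<close> and lists
  precisely the partial functions computable in \<open>X\<close>.
\<close>

lemma bij_prog_encode: "bij prog_encode"
  by (simp add: bij_def inj_prog_encode surj_prog_encode)

definition phi :: "nat set \<Rightarrow> nat \<Rightarrow> nat \<Rightarrow> nat option" where
  "phi X e = run X (inv prog_encode e)"

definition computable_in :: "nat set \<Rightarrow> (nat \<Rightarrow> nat) \<Rightarrow> bool" where
  "computable_in X f \<longleftrightarrow> (\<exists>e. \<forall>x. phi X e x = Some (f x))"

definition computable :: "(nat \<Rightarrow> nat) \<Rightarrow> bool" where
  "computable f \<longleftrightarrow> computable_in {} f"

definition turing_le :: "nat set \<Rightarrow> nat set \<Rightarrow> bool" (infix "\<le>\<^sub>T" 50) where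
  "A \<le>\<^sub>T B \<longleftrightarrow> computable_in B (\<lambda>x. of_bool (x \<in> A))"

definition turing_jump :: "nat set \<Rightarrow> nat set" where
  "turing_jump X = {e. phi X e e \<noteq> None}"

definition monochromatic :: "(nat \<Rightarrow> nat) \<Rightarrow> nat set \<Rightarrow> bool" where
  "monochromatic c S \<longleftrightarrow> (\<exists>i. \<forall>x\<in>S. c x = i)"

text \<open>
  \<^term>\<open>set_decode n\<close> is the set of exponents \<open>{t\<^sub>1, \<dots>, t\<^sub>k}\<close> in the binary expansion
  of \<open>n\<close>. The two functions below are meaningful for \<open>n > 0\<close> only.
\<close>

definition lambda_exp :: "nat \<Rightarrow> nat" where
  "lambda_exp n = Min (set_decode n)"

definition mu_exp :: "nat \<Rightarrow> nat" where
  "mu_exp n = Max (set_decode n)"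

definition apart :: "nat set \<Rightarrow> bool" where
  "apart X \<longleftrightarrow> (\<forall>x\<in>X. \<forall>x'\<in>X. x < x' \<longrightarrow> mu_exp x < lambda_exp x')"

definition FS :: "nat set \<Rightarrow> nat set \<Rightarrow> nat set" where
  "FS A Y = {\<Sum>F | F. finite F \<and> F \<subseteq> Y \<and> card F \<in> A}"

definition brauer_property :: "nat \<Rightarrow> nat \<Rightarrow> nat \<Rightarrow> nat \<Rightarrow> bool" where
  "brauer_property r l s n \<longleftrightarrow>
     (\<forall>g \<in> {1..n} \<rightarrow> {..<r}. \<exists>a>0. \<exists>b>0.
        {a + i * b | i. i < l} \<union> {s * b} \<subseteq> {1..n} \<and>
        monochromatic g ({a + i * b | i. i < l} \<union> {s * b}))"

definition brauer_number :: "nat \<Rightarrow> nat \<Rightarrow> nat \<Rightarrow> nat" where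
  "brauer_number r l s = (LEAST n. brauer_property r l s n)"

end

theory Submission
  imports Defs "HOL-Library.Diagonal_Subsequence" "HOL-Library.Infinite_Set"
begin

text \<open>
  A number codes the finite set of its binary exponents, so for \<open>H = {2 ^ t | t \<in> A}\<close> the sums of
  \<open>j\<close> elements of \<open>H\<close> are the codes of the \<open>j\<close>-element subsets of \<open>A\<close>. As in Jockusch's proof of
  Ramsey's theorem, an infinite set is thinned to one on which \<open>c\<close> does not depend on the largest
  element of a set. Such a set is a path through the Erdos-Rado tree; forcing the jump along the
  path as in the low basis theorem gives a path whose jump is computable in two jumps of the
  previous oracle. Removing the largest element yields a coloring of the smaller sets, and
  \<open>n - 1\<close> such rounds followed by one use of the pigeonhole principle make all \<open>j\<close>-element subsets
  with \<open>j \<le> n\<close> monochromatic at the cost of \<open>n\<close> jumps. Brauer's theorem for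
  \<open>n = B(2,3,1)\<close> then selects \<open>a\<close> and \<open>b\<close>.
\<close>

section \<open>Relative computability\<close>

text \<open>The counting of jumps dictates the invariant. An end-homogeneous set merely computed
  from two jumps of \<open>Y\<close> would have its own jump bounded only by three. So each round
  bounds the jump of an oracle that computes both the current set and the current coloring: it
  replaces \<open>Y\<close> by some \<open>Z\<close> with
  \<open>turing_jump Z \<le>\<^sub>T turing_jump (turing_jump Y)\<close>. If
  \<open>turing_jump Y\<close> is below the \<open>Suc j\<close>-th jump of the empty set,
  \<open>turing_jump Z\<close> is below the next one, so a round costs one jump although infinitude
  of a subtree is decided with two. The empty oracle starts with one jump, and the closing
  pigeonhole step adds none.

  The numbers \<open>a\<close> and \<open>b\<close> cannot be fixed beforehand, since they depend on
  the colors that the construction produces. Therefore every cardinality up to \<open>n\<close> is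
  made monochromatic, each with its own color, and Brauer's theorem is applied afterwards to the map
  from cardinalities to colors. Only the existence of programs is claimed, so finitely many facts,
  such as the color kept by the pigeonhole step, may be built into a program as constants.\<close>

lemma computable_in_iff_run: "computable_in X f \<longleftrightarrow> (\<exists>p. \<forall>x. run X p x = Some (f x))"
  unfolding computable_in_def phi_def
  by (metis bij_prog_encode bij_inv_eq_iff)

definition dec :: "nat set \<Rightarrow> (nat \<Rightarrow> bool) \<Rightarrow> bool" where
  "dec X P \<longleftrightarrow> computable_in X (\<lambda>x. of_bool (P x))"

lemma turing_le_iff_dec: "A \<le>\<^sub>T B \<longleftrightarrow> dec B (\<lambda>x. x \<in> A)"
  by (simp add: turing_le_def dec_def)

primrec const_prog :: "nat \<Rightarrow> prog" where
  "const_prog 0 = OZero"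
| "const_prog (Suc n) = OComp OSucc (const_prog n)"

lemma run_const_prog [simp]: "run X (const_prog n) x = Some n"
  by (induction n) auto

named_theorems comp_intros

lemma comp_const [comp_intros]: "computable_in X (\<lambda>x. k)"
  unfolding computable_in_iff_run using run_const_prog by blast

lemma comp_id [comp_intros]: "computable_in X (\<lambda>x. x)"
  unfolding computable_in_iff_run by (rule exI[of _ "OPair OFst OSnd"]) simp

lemma comp_compose:
  assumes "computable_in X f" "computable_in X g"
  shows "computable_in X (\<lambda>x. f (g x))"
proof -
  obtain p q where "\<forall>x. run X p x = Some (f x)" "\<forall>x. run X q x = Some (g x)"
    using assms unfolding computable_in_iff_run by blast
  then show ?thesis
    unfolding computable_in_iff_run by (intro exI[of _ "OComp p q"]) simp
qed

lemma comp_Suc [comp_intros]: "computable_in X f \<Longrightarrow> computable_in X (\<lambda>x. Suc (f x))"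
  by (rule comp_compose[of X Suc]) (auto simp: computable_in_iff_run intro!: exI[of _ OSucc])

lemma comp_fst [comp_intros]:
  "computable_in X f \<Longrightarrow> computable_in X (\<lambda>x. fst (prod_decode (f x)))"
  by (rule comp_compose[of X "\<lambda>x. fst (prod_decode x)"])
    (auto simp: computable_in_iff_run intro!: exI[of _ OFst])

lemma comp_snd [comp_intros]:
  "computable_in X f \<Longrightarrow> computable_in X (\<lambda>x. snd (prod_decode (f x)))"
  by (rule comp_compose[of X "\<lambda>x. snd (prod_decode x)"])
    (auto simp: computable_in_iff_run intro!: exI[of _ OSnd])

lemma comp_pair [comp_intros]:
  assumes "computable_in X f" "computable_in X g"
  shows "computable_in X (\<lambda>x. prod_encode (f x, g x))"
proof -
  obtain p q where "\<forall>x. run X p x = Some (f x)" "\<forall>x. run X q x = Some (g x)"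
    using assms unfolding computable_in_iff_run by blast
  then show ?thesis
    unfolding computable_in_iff_run by (intro exI[of _ "OPair p q"]) simp
qed

text \<open>The step \<open>h\<close> may depend on the input \<open>x\<close>, which
  \<open>ORec\<close> passes along as the first component of its nested pairs; the premise on
  \<open>h\<close> mirrors this nesting.\<close>

lemma comp_rec:
  assumes g: "computable_in X g" and n: "computable_in X n"
    and h: "computable_in X (\<lambda>z. h (fst (prod_decode z)) (fst (prod_decode (snd (prod_decode z))))
              (snd (prod_decode (snd (prod_decode z)))))"
  shows "computable_in X (\<lambda>x. rec_nat (g x) (\<lambda>m r. h x m r) (n x))"
proof -
  obtain p q where p: "\<forall>x. run X p x = Some (g x)"
    and q: "\<forall>z. run X q z = Some (h (fst (prod_decode z)) (fst (prod_decode (snd (prod_decode z))))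
              (snd (prod_decode (snd (prod_decode z)))))"
    using g h unfolding computable_in_iff_run by blast
  have "run X (ORec p q) (prod_encode (a, k)) = Some (rec_nat (g a) (h a) k)" for a k
    by (induction k) (auto simp: p q)
  then have "computable_in X (\<lambda>z. rec_nat (g (fst (prod_decode z))) (h (fst (prod_decode z))) (snd (prod_decode z)))"
    unfolding computable_in_iff_run
    by (metis prod_decode_inverse prod.collapse)
  from comp_compose[OF this comp_pair[OF comp_id n]] show ?thesis
    by simp
qed

lemma comp_add [comp_intros]:
  assumes "computable_in X f" "computable_in X g"
  shows "computable_in X (\<lambda>x. f x + g x)"
proof -
  have eq: "rec_nat a (\<lambda>m r. Suc r) n = a + n" for a n :: nat by (induction n) auto
  show ?thesis
    unfolding eq[symmetric] by (intro comp_rec assms comp_intros)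
qed

lemma comp_mult [comp_intros]:
  assumes "computable_in X f" "computable_in X g"
  shows "computable_in X (\<lambda>x. f x * g x)"
proof -
  have eq: "rec_nat 0 (\<lambda>m r. r + a) n = a * n" for a n :: nat by (induction n) auto
  show ?thesis
    unfolding eq[symmetric] by (intro comp_rec assms comp_intros comp_compose[OF assms(1)])
qed

lemma comp_power [comp_intros]:
  assumes "computable_in X f" "computable_in X g"
  shows "computable_in X (\<lambda>x. f x ^ g x)"
proof -
  have eq: "rec_nat 1 (\<lambda>m r. r * a) n = a ^ n" for a n :: nat by (induction n) auto
  show ?thesis
    unfolding eq[symmetric] by (intro comp_rec assms comp_intros comp_compose[OF assms(1)])
qed

text \<open>Truncated subtraction iterates the predecessor, which is itself a recursion returning
  the stage and ignoring the accumulator.\<close>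

lemma comp_diff [comp_intros]:
  assumes "computable_in X f" "computable_in X g"
  shows "computable_in X (\<lambda>x. f x - g x)"
proof -
  have "rec_nat 0 (\<lambda>m r. m) n = n - 1" for n :: nat by (cases n) auto
  moreover have "computable_in X (\<lambda>n. rec_nat 0 (\<lambda>m r. m) n)"
    by (intro comp_rec comp_intros)
  ultimately have pred: "computable_in X (\<lambda>n. n - 1)" by simp
  have "rec_nat a (\<lambda>m r. r - 1) n = a - n" for a n :: nat by (induction n) auto
  moreover have "computable_in X (\<lambda>x. rec_nat (f x) (\<lambda>m r. r - 1) (g x))"
    by (intro comp_rec assms comp_compose[OF pred] comp_intros)
  ultimately show ?thesis by simp
qed

lemma comp_of_bool [comp_intros]:
  "dec X P \<Longrightarrow> computable_in X (\<lambda>x. of_bool (P x))"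
  by (simp add: dec_def)

lemma comp_if [comp_intros]:
  assumes P: "dec X P" and f: "computable_in X f" and g: "computable_in X g"
  shows "computable_in X (\<lambda>x. if P x then f x else g x)"
proof -
  have eq: "(if b then a else a') = rec_nat a' (\<lambda>m r. a) (of_bool b)" for b and a a' :: nat
    by (cases b) auto
  show ?thesis
    unfolding eq
    by (intro comp_rec comp_intros P g comp_compose[OF f])
qed

section \<open>Closure properties of decidable predicates\<close>

lemma dec_const [comp_intros]: "dec X (\<lambda>x. b)"
  unfolding dec_def by (rule comp_const)

lemma dec_compose:
  assumes "dec X P" "computable_in X f"
  shows "dec X (\<lambda>x. P (f x))"
  using assms comp_compose unfolding dec_def by fastforce

lemma dec_compose2:
  assumes "dec X (\<lambda>z. P (fst (prod_decode z)) (snd (prod_decode z)))"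
    and "computable_in X f" "computable_in X g"
  shows "dec X (\<lambda>x. P (f x) (g x))"
  using dec_compose[OF assms(1) comp_pair[OF assms(2,3)]] by simp

lemma dec_if:
  assumes "dec X P" "dec X Q" "dec X R"
  shows "dec X (\<lambda>x. if P x then Q x else R x)"
proof -
  have eq: "of_bool (if b then b1 else b2) = (if b then of_bool b1 else of_bool b2 :: nat)" for b b1 b2
    by simp
  show ?thesis
    unfolding dec_def eq using assms by (intro comp_intros)
qed

lemma dec_not [comp_intros]:
  assumes "dec X P"
  shows "dec X (\<lambda>x. \<not> P x)"
proof -
  have eq: "(\<not> b) = (if b then False else True)" for b
    by simp
  show ?thesis
    unfolding eq by (intro dec_if dec_const assms)
qed

lemma dec_conj [comp_intros]:
  assumes "dec X P" "dec X Q"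
  shows "dec X (\<lambda>x. P x \<and> Q x)"
proof -
  have eq: "(b \<and> b') = (if b then b' else False)" for b b'
    by simp
  show ?thesis
    unfolding eq by (intro dec_if dec_const assms)
qed

lemma dec_disj [comp_intros]:
  assumes "dec X P" "dec X Q"
  shows "dec X (\<lambda>x. P x \<or> Q x)"
proof -
  have eq: "(b \<or> b') = (if b then True else b')" for b b'
    by simp
  show ?thesis
    unfolding eq by (intro dec_if dec_const assms)
qed

lemma dec_imp [comp_intros]:
  assumes "dec X P" "dec X Q"
  shows "dec X (\<lambda>x. P x \<longrightarrow> Q x)"
  unfolding imp_conv_disj by (intro comp_intros assms)

lemma dec_eq_0:
  assumes "computable_in X f"
  shows "dec X (\<lambda>x. f x = 0)"
proof -
  have eq: "of_bool (n = 0) = 1 - n" for n :: nat by (cases n) auto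
  show ?thesis unfolding dec_def eq by (intro comp_intros assms)
qed

lemma dec_le [comp_intros]:
  assumes "computable_in X f" "computable_in X g"
  shows "dec X (\<lambda>x. f x \<le> g x)"
  unfolding diff_is_0_eq[symmetric] by (intro dec_eq_0 comp_intros assms)

lemma dec_less [comp_intros]:
  assumes "computable_in X f" "computable_in X g"
  shows "dec X (\<lambda>x. f x < g x)"
  unfolding Suc_le_eq[symmetric] by (intro comp_intros assms)

lemma dec_eq [comp_intros]:
  assumes "computable_in X f" "computable_in X g"
  shows "dec X (\<lambda>x. f x = g x)"
  unfolding order.eq_iff[of "f _"] by (intro comp_intros assms)

lemma dec_bex [comp_intros]:
  assumes b: "computable_in X b"
    and P: "dec X (\<lambda>z. P (fst (prod_decode z)) (snd (prod_decode z)))"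
  shows "dec X (\<lambda>x. \<exists>y<b x. P x y)"
proof -
  have eq: "of_bool (\<exists>y<n. Q y) = rec_nat 0 (\<lambda>m r. if Q m then 1 else r) n" for Q and n :: nat
    by (induction n) (simp_all add: less_Suc_eq ex_disj_distrib conj_disj_distribR)
  show ?thesis
    unfolding dec_def eq
    by (intro comp_rec b comp_intros dec_compose2[where P = P, OF P])
qed

lemma dec_ball [comp_intros]:
  assumes b: "computable_in X b"
    and P: "dec X (\<lambda>z. P (fst (prod_decode z)) (snd (prod_decode z)))"
  shows "dec X (\<lambda>x. \<forall>y<b x. P x y)"
proof -
  have "dec X (\<lambda>x. \<not> (\<exists>y<b x. \<not> P x y))"
    by (intro comp_intros assms)
  then show ?thesis by simp
qed

lemma comp_Least:
  assumes P: "dec X (\<lambda>z. P (fst (prod_decode z)) (snd (prod_decode z)))"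
    and ex: "\<And>x. \<exists>n. P x n"
  shows "computable_in X (\<lambda>x. LEAST n. P x n)"
proof -
  have "computable_in X (\<lambda>z. of_bool (\<not> P (fst (prod_decode z)) (snd (prod_decode z))))"
    by (intro comp_intros P)
  then obtain p where p: "\<And>z. run X p z = Some (of_bool (\<not> P (fst (prod_decode z)) (snd (prod_decode z))))"
    unfolding computable_in_iff_run by blast
  have "run X (OMin p) x = Some (LEAST n. P x n)" for x
    using ex[of x] by (auto simp: p)
  then show ?thesis unfolding computable_in_iff_run by blast
qed

text \<open>Bounded quantifiers and arithmetic replace \<open>div\<close> and \<open>odd\<close>, so
  the closure rules already decide membership. A set bit means
  \<open>w = (2 * q + 1) * 2 ^ x + r\<close> with remainder \<open>r < 2 ^ x\<close>, and then
  \<open>q\<close> is at most \<open>w\<close>.\<close>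

lemma in_set_decode_iff:
  "x \<in> set_decode w \<longleftrightarrow> (\<exists>q<Suc w. \<exists>r<2 ^ x. w = q * (2 * 2 ^ x) + 2 ^ x + r)"
proof
  assume "x \<in> set_decode w"
  then have "odd (w div 2 ^ x)" by (simp add: set_decode_def)
  then obtain q where q: "w div 2 ^ x = 2 * q + 1" by (elim oddE)
  have "w = (w div 2 ^ x) * 2 ^ x + w mod 2 ^ x" by (rule div_mult_mod_eq[symmetric])
  then have "w = q * (2 * 2 ^ x) + 2 ^ x + w mod 2 ^ x"
    by (simp add: q algebra_simps)
  moreover from q have "2 * q + 1 \<le> w" by (metis div_le_dividend)
  ultimately show "\<exists>q<Suc w. \<exists>r<2 ^ x. w = q * (2 * 2 ^ x) + 2 ^ x + r"
    by (intro exI[of _ q] conjI exI[of _ "w mod 2 ^ x"]) auto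
next
  assume "\<exists>q<Suc w. \<exists>r<2 ^ x. w = q * (2 * 2 ^ x) + 2 ^ x + r"
  then obtain q r where "r < 2 ^ x" "w = (2 * q + 1) * 2 ^ x + r"
    by (auto simp: algebra_simps)
  then have "w div 2 ^ x = 2 * q + 1" by (simp del: mult_Suc add: div_mult_self3[of "2 ^ x" "2 * q + 1" r, simplified])
  then show "x \<in> set_decode w" by (simp add: set_decode_def)
qed

lemma dec_set_decode [comp_intros]:
  assumes f: "computable_in X f" and g: "computable_in X g"
  shows "dec X (\<lambda>x. f x \<in> set_decode (g x))"
  unfolding in_set_decode_iff
  by (intro comp_intros comp_compose[OF f] comp_compose[OF g])

lemma in_set_decode_less: "x \<in> set_decode w \<Longrightarrow> x < w"
proof -
  assume "x \<in> set_decode w"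
  then have "2 ^ x \<le> w" unfolding in_set_decode_iff by auto
  moreover have "x < 2 ^ x" by (rule less_exp)
  ultimately show "x < w" by linarith
qed

lemma dec_oracle: "computable_in X f \<Longrightarrow> dec X (\<lambda>x. f x \<in> X)"
  by (rule dec_compose[of X "\<lambda>x. x \<in> X"])
    (auto simp: dec_def computable_in_iff_run intro!: exI[of _ OQuery])

lemma dec_turing_le: "A \<le>\<^sub>T X \<Longrightarrow> computable_in X f \<Longrightarrow> dec X (\<lambda>x. f x \<in> A)"
  unfolding turing_le_iff_dec by (rule dec_compose)

section \<open>Turing reductions as program substitution\<close>

primrec answer :: "prog \<Rightarrow> prog \<Rightarrow> prog" where
  "answer r OZero = OZero"
| "answer r OSucc = OSucc"
| "answer r OFst = OFst"
| "answer r OSnd = OSnd"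
| "answer r OQuery = r"
| "answer r (OPair p q) = OPair (answer r p) (answer r q)"
| "answer r (OComp p q) = OComp (answer r p) (answer r q)"
| "answer r (ORec p q) = ORec (answer r p) (answer r q)"
| "answer r (OMin p) = OMin (answer r p)"

text \<open>A program deciding \<open>A\<close> from \<open>B\<close> can stand in for every oracle
  query, so computations relative to \<open>A\<close> become computations relative to
  \<open>B\<close>. Transitivity of \<open>\<le>\<^sub>T\<close> follows from this.\<close>

lemma run_answer:
  assumes "\<And>x. run B r x = Some (of_bool (x \<in> A))"
  shows "run B (answer r p) = run A p"
proof (induction p)
  case OQuery then show ?case by (simp add: assms fun_eq_iff)
qed (rule ext; simp)+

lemma computable_in_mono:
  assumes "A \<le>\<^sub>T B" "computable_in A f"
  shows "computable_in B f"
proof -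
  obtain r p where "\<And>x. run B r x = Some (of_bool (x \<in> A))" "\<And>x. run A p x = Some (f x)"
    using assms unfolding turing_le_def computable_in_iff_run by blast
  then have "\<And>x. run B (answer r p) x = Some (f x)" by (simp add: run_answer)
  then show ?thesis unfolding computable_in_iff_run by blast
qed

lemma turing_le_refl: "A \<le>\<^sub>T A"
  unfolding turing_le_iff_dec by (rule dec_oracle[OF comp_id])

lemma turing_le_trans: "A \<le>\<^sub>T B \<Longrightarrow> B \<le>\<^sub>T C \<Longrightarrow> A \<le>\<^sub>T C"
  unfolding turing_le_def by (rule computable_in_mono) (auto simp: turing_le_def)

text \<open>
  The code of a program that ignores its input and searches for a witness for \<open>a\<close> depends
  computably on \<open>a\<close>, so that a single query to the jump answers the question.
\<close>

lemma dec_ex_turing_jump: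
  assumes P: "dec X (\<lambda>z. P (fst (prod_decode z)) (snd (prod_decode z)))"
  shows "dec (turing_jump X) (\<lambda>a. \<exists>n. P a n)"
proof -
  have "computable_in X (\<lambda>z. of_bool (\<not> P (fst (prod_decode z)) (snd (prod_decode z))))"
    by (intro comp_intros P)
  then obtain p where p: "\<And>z. run X p z = Some (of_bool (\<not> P (fst (prod_decode z)) (snd (prod_decode z))))"
    unfolding computable_in_iff_run by blast
  \<comment> \<open>\<open>OSucc\<close> has code 1 and \<open>OComp\<close> the tag 6, so the
    recursion step is the code of composing \<open>OSucc\<close> with the program coded by
    \<open>r\<close>.\<close>
  define k where "k a = rec_nat 0 (\<lambda>m r. 6 + 4 * prod_encode (1, r)) a" for a
  have k: "prog_encode (const_prog a) = k a" for a
    by (induction a) (auto simp: k_def)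
  define e where "e a = 6 + 4 * prod_encode (prog_encode (OMin p), k a)" for a
  have e: "e a = prog_encode (OComp (OMin p) (const_prog a))" for a
    by (simp add: e_def k)
  have "e a \<in> turing_jump X \<longleftrightarrow> run X (OMin p) a \<noteq> None" for a
    unfolding turing_jump_def phi_def e by (simp add: inv_f_f[OF inj_prog_encode] del: run.simps(9) prog_encode.simps)
  also have "\<And>a. run X (OMin p) a \<noteq> None \<longleftrightarrow> (\<exists>n. P a n)"
    by (auto simp: p)
  finally have eq: "\<And>a. (\<exists>n. P a n) \<longleftrightarrow> e a \<in> turing_jump X" by simp
  have "computable_in (turing_jump X) e"
    unfolding e_def k_def by (intro comp_intros comp_rec)
  then show ?thesis
    unfolding eq by (rule dec_oracle)
qed


section \<open>Certificates for halting computations\<close>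

text \<open>
  A certificate is a finite set of triples \<open>(e, x, v)\<close>, read as "program \<open>e\<close> yields \<open>v\<close> on \<open>x\<close>", in
  which every triple follows from others by one evaluation step. No well-foundedness is required:
  each step descends in the program or in the recursion argument. Since a member of
  \<^term>\<open>set_decode w\<close> is below \<open>w\<close>, the code \<open>w\<close> also bounds the oracle queries.
\<close>

definition triple :: "nat \<Rightarrow> nat \<Rightarrow> nat \<Rightarrow> nat" where
  "triple e x v = prod_encode (e, prod_encode (x, v))"

lemma triple_inj [simp]: "triple e x v = triple e' x' v' \<longleftrightarrow> e = e' \<and> x = x' \<and> v = v'"
  by (simp add: triple_def)

lemma triple_ge: "e \<le> triple e x v" "x \<le> triple e x v" "v \<le> triple e x v"
  unfolding triple_def
  using le_prod_encode_1[of e "prod_encode (x, v)"] le_prod_encode_2[of "prod_encode (x, v)" e]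
    le_prod_encode_1[of x v] le_prod_encode_2[of v x]
  by linarith+

definition justified :: "nat set \<Rightarrow> nat set \<Rightarrow> nat \<Rightarrow> nat \<Rightarrow> nat \<Rightarrow> bool" where
  "justified X W e x v \<longleftrightarrow>
     e = 0 \<and> v = 0 \<or>
     e = 1 \<and> v = Suc x \<or>
     e = 2 \<and> v = fst (prod_decode x) \<or>
     e = 3 \<and> v = snd (prod_decode x) \<or>
     e = 4 \<and> v = of_bool (x \<in> X) \<or>
     (\<exists>p q u u'. e = 5 + 4 * prod_encode (p, q) \<and> v = prod_encode (u, u') \<and>
        triple p x u \<in> W \<and> triple q x u' \<in> W) \<or>
     (\<exists>p q u. e = 6 + 4 * prod_encode (p, q) \<and> triple q x u \<in> W \<and> triple p u v \<in> W) \<or>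
     (\<exists>p q a. e = 7 + 4 * prod_encode (p, q) \<and> x = prod_encode (a, 0) \<and> triple p a v \<in> W) \<or>
     (\<exists>p q a m u. e = 7 + 4 * prod_encode (p, q) \<and> x = prod_encode (a, Suc m) \<and>
        triple e (prod_encode (a, m)) u \<in> W \<and>
        triple q (prod_encode (a, prod_encode (m, u))) v \<in> W) \<or>
     (\<exists>p. e = 8 + 4 * p \<and> triple p (prod_encode (x, v)) 0 \<in> W \<and>
        (\<forall>m<v. \<exists>u. triple p (prod_encode (x, m)) (Suc u) \<in> W))"

definition certificate :: "nat set \<Rightarrow> nat set \<Rightarrow> bool" where
  "certificate X W \<longleftrightarrow> (\<forall>e x v. triple e x v \<in> W \<longrightarrow> justified X W e x v)"

lemma justified_prog_encode:
  "justified X W (prog_encode OZero) x v \<longleftrightarrow> v = 0"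
  "justified X W (prog_encode OSucc) x v \<longleftrightarrow> v = Suc x"
  "justified X W (prog_encode OFst) x v \<longleftrightarrow> v = fst (prod_decode x)"
  "justified X W (prog_encode OSnd) x v \<longleftrightarrow> v = snd (prod_decode x)"
  "justified X W (prog_encode OQuery) x v \<longleftrightarrow> v = of_bool (x \<in> X)"
  "justified X W (prog_encode (OPair p q)) x v \<longleftrightarrow>
     (\<exists>u u'. v = prod_encode (u, u') \<and> triple (prog_encode p) x u \<in> W \<and>
        triple (prog_encode q) x u' \<in> W)"
  "justified X W (prog_encode (OComp p q)) x v \<longleftrightarrow>
     (\<exists>u. triple (prog_encode q) x u \<in> W \<and> triple (prog_encode p) u v \<in> W)"
  "justified X W (prog_encode (ORec p q)) x v \<longleftrightarrow>
     (\<exists>a. x = prod_encode (a, 0) \<and> triple (prog_encode p) a v \<in> W) \<or>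
     (\<exists>a m u. x = prod_encode (a, Suc m) \<and>
        triple (prog_encode (ORec p q)) (prod_encode (a, m)) u \<in> W \<and>
        triple (prog_encode q) (prod_encode (a, prod_encode (m, u))) v \<in> W)"
  "justified X W (prog_encode (OMin p)) x v \<longleftrightarrow>
     triple (prog_encode p) (prod_encode (x, v)) 0 \<in> W \<and>
     (\<forall>m<v. \<exists>u. triple (prog_encode p) (prod_encode (x, m)) (Suc u) \<in> W)"
proof -
  have ne: "5 + 4 * a \<noteq> 6 + 4 * b" "5 + 4 * a \<noteq> 7 + 4 * b" "5 + 4 * a \<noteq> 8 + 4 * b"
    "6 + 4 * a \<noteq> 7 + 4 * b" "6 + 4 * a \<noteq> 8 + 4 * b" "7 + 4 * a \<noteq> 8 + 4 * b"
    "6 + 4 * b \<noteq> 5 + 4 * a" "7 + 4 * b \<noteq> 5 + 4 * a" "8 + 4 * b \<noteq> 5 + 4 * a"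
    "7 + 4 * b \<noteq> 6 + 4 * a" "8 + 4 * b \<noteq> 6 + 4 * a" "8 + 4 * b \<noteq> 7 + 4 * a"
    for a b :: nat by presburger+
  show
    "justified X W (prog_encode OZero) x v \<longleftrightarrow> v = 0"
    "justified X W (prog_encode OSucc) x v \<longleftrightarrow> v = Suc x"
    "justified X W (prog_encode OFst) x v \<longleftrightarrow> v = fst (prod_decode x)"
    "justified X W (prog_encode OSnd) x v \<longleftrightarrow> v = snd (prod_decode x)"
    "justified X W (prog_encode OQuery) x v \<longleftrightarrow> v = of_bool (x \<in> X)"
    by (simp_all add: justified_def)
  show
    "justified X W (prog_encode (OPair p q)) x v \<longleftrightarrow>
     (\<exists>u u'. v = prod_encode (u, u') \<and> triple (prog_encode p) x u \<in> W \<and>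
        triple (prog_encode q) x u' \<in> W)"
    "justified X W (prog_encode (OComp p q)) x v \<longleftrightarrow>
     (\<exists>u. triple (prog_encode q) x u \<in> W \<and> triple (prog_encode p) u v \<in> W)"
    "justified X W (prog_encode (ORec p q)) x v \<longleftrightarrow>
     (\<exists>a. x = prod_encode (a, 0) \<and> triple (prog_encode p) a v \<in> W) \<or>
     (\<exists>a m u. x = prod_encode (a, Suc m) \<and>
        triple (prog_encode (ORec p q)) (prod_encode (a, m)) u \<in> W \<and>
        triple (prog_encode q) (prod_encode (a, prod_encode (m, u))) v \<in> W)"
    "justified X W (prog_encode (OMin p)) x v \<longleftrightarrow>
     triple (prog_encode p) (prod_encode (x, v)) 0 \<in> W \<and>
     (\<forall>m<v. \<exists>u. triple (prog_encode p) (prod_encode (x, m)) (Suc u) \<in> W)"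
    unfolding justified_def by (simp_all add: ne)
qed

lemma certificateD: "certificate X W \<Longrightarrow> triple e x v \<in> W \<Longrightarrow> justified X W e x v"
  unfolding certificate_def by blast

lemma certificate_sound:
  assumes W: "certificate X W"
  shows "triple (prog_encode P) x v \<in> W \<Longrightarrow> run X P x = Some v"
proof (induction P arbitrary: x v)
  case (OPair p q)
  with certificateD[OF W OPair.prems] show ?case
    unfolding justified_prog_encode by auto
next
  case (OComp p q)
  with certificateD[OF W OComp.prems] show ?case
    unfolding justified_prog_encode by auto
next
  case (ORec p q)
  have *: "triple (prog_encode (ORec p q)) (prod_encode (a, n)) v \<in> W \<Longrightarrow>
      run X (ORec p q) (prod_encode (a, n)) = Some v" for a n v
  proof (induction n arbitrary: v)
    case 0
    from certificateD[OF W 0] have "triple (prog_encode p) a v \<in> W"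
      unfolding justified_prog_encode by auto
    then show ?case using ORec.IH(1) by simp
  next
    case (Suc n)
    from certificateD[OF W Suc.prems]
    obtain u where "triple (prog_encode (ORec p q)) (prod_encode (a, n)) u \<in> W"
      and u: "triple (prog_encode q) (prod_encode (a, prod_encode (n, u))) v \<in> W"
      unfolding justified_prog_encode by auto
    with Suc.IH[of u] ORec.IH(2)[OF u] show ?case by simp
  qed
  show ?case
    using *[of "fst (prod_decode x)" "snd (prod_decode x)" v] ORec.prems
    by (simp del: run.simps prog_encode.simps)
next
  case (OMin p)
  from certificateD[OF W OMin.prems]
  have 0: "run X p (prod_encode (x, v)) = Some 0"
    and pos: "\<forall>m<v. \<exists>u. run X p (prod_encode (x, m)) = Some (Suc u)"
    using OMin.IH unfolding justified_prog_encode by blast+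
  \<comment> \<open>The certificate records a successor value at each \<open>m < v\<close>, so no
    zero occurs before \<open>v\<close>.\<close>
  have "(LEAST n. run X p (prod_encode (x, n)) = Some 0) = v"
  proof (rule Least_equality)
    show "v \<le> n" if "run X p (prod_encode (x, n)) = Some 0" for n
      using that pos by (metis Zero_not_Suc not_le option.inject)
  qed (rule 0)
  moreover have "\<forall>m<v. run X p (prod_encode (x, m)) \<noteq> None"
    using pos by fastforce
  ultimately show ?case using 0 by auto
qed (drule certificateD[OF W]; simp only: justified_prog_encode run.simps)+

lemma justified_mono: "justified X W e x v \<Longrightarrow> W \<subseteq> W' \<Longrightarrow> justified X W' e x v"
  unfolding justified_def by (elim disj_forward; blast)

lemma certificate_Union:
  assumes "\<And>W. W \<in> \<W> \<Longrightarrow> certificate X W"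
  shows "certificate X (\<Union>\<W>)"
  using assms justified_mono unfolding certificate_def by (meson UnionE Union_upper)

lemma certificate_insert:
  assumes "certificate X W" "justified X W e x v"
  shows "certificate X (insert (triple e x v) W)"
  using assms justified_mono[OF _ subset_insertI]
  unfolding certificate_def by (metis insert_iff triple_inj)

definition certified :: "nat set \<Rightarrow> prog \<Rightarrow> nat \<Rightarrow> nat \<Rightarrow> bool" where
  "certified X P x v \<longleftrightarrow> (\<exists>W. finite W \<and> certificate X W \<and> triple (prog_encode P) x v \<in> W)"

text \<open>\<open>T\<close> collects the immediate premises of one evaluation step. Their
  certificates are united and the conclusion is added, so that completeness reduces to checking
  \<open>justified\<close> for each program constructor.\<close>

lemma certifiedI:
  assumes "\<And>t. t \<in> T \<Longrightarrow> certified X (fst t) (fst (snd t)) (snd (snd t))" "finite T"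
    and J: "\<And>W. (\<forall>t\<in>T. triple (prog_encode (fst t)) (fst (snd t)) (snd (snd t)) \<in> W) \<Longrightarrow>
           justified X W (prog_encode P) x v"
  shows "certified X P x v"
proof -
  have "\<forall>t\<in>T. \<exists>W. finite W \<and> certificate X W \<and>
      triple (prog_encode (fst t)) (fst (snd t)) (snd (snd t)) \<in> W"
    using assms(1) unfolding certified_def by blast
  from bchoice[OF this] obtain W where W: "\<forall>t\<in>T. finite (W t) \<and> certificate X (W t) \<and>
      triple (prog_encode (fst t)) (fst (snd t)) (snd (snd t)) \<in> W t"
    by (rule exE)
  then have "\<forall>t\<in>T. triple (prog_encode (fst t)) (fst (snd t)) (snd (snd t)) \<in> \<Union>(W ` T)"
    by (meson UN_I)
  then have "justified X (\<Union>(W ` T)) (prog_encode P) x v"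
    by (rule J)
  moreover have "certificate X (\<Union>(W ` T))"
    by (rule certificate_Union) (use W in blast)
  ultimately have "certificate X (insert (triple (prog_encode P) x v) (\<Union>(W ` T)))"
    by (intro certificate_insert)
  moreover have "finite (insert (triple (prog_encode P) x v) (\<Union>(W ` T)))"
    using W \<open>finite T\<close> by (intro finite.insertI finite_UN_I) blast+
  ultimately show ?thesis
    unfolding certified_def using insertI1 by (intro exI conjI)
qed

lemma certificate_complete: "run X P x = Some v \<Longrightarrow> certified X P x v"
proof (induction P arbitrary: x v)
  case (OPair p q)
  from OPair.prems obtain u u' where u: "run X p x = Some u" "run X q x = Some u'"
    and v: "v = prod_encode (u, u')"
    by (auto simp: bind_eq_Some_conv)
  show ?case
  proof (rule certifiedI[of "{(p, x, u), (q, x, u')}"])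
    fix W
    assume "\<forall>t\<in>{(p, x, u), (q, x, u')}. triple (prog_encode (fst t)) (fst (snd t)) (snd (snd t)) \<in> W"
    then show "justified X W (prog_encode (OPair p q)) x v"
      unfolding justified_prog_encode v by auto
  qed (use OPair.IH u in auto)
next
  case (OComp p q)
  from OComp.prems obtain u where u: "run X q x = Some u" "run X p u = Some v"
    by (auto simp: bind_eq_Some_conv)
  show ?case
    by (rule certifiedI[of "{(q, x, u), (p, u, v)}"])
      (use OComp.IH u in \<open>auto simp: justified_prog_encode simp del: prog_encode.simps\<close>)
next
  case (ORec p q)
  have "run X (ORec p q) (prod_encode (a, n)) = Some v \<Longrightarrow>
      certified X (ORec p q) (prod_encode (a, n)) v" for a n v
  proof (induction n arbitrary: v)
    case 0
    then have c: "certified X p a v" using ORec.IH(1) by simp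
    show ?case
    proof (rule certifiedI[of "{(p, a, v)}"])
      fix W
      assume "\<forall>t\<in>{(p, a, v)}. triple (prog_encode (fst t)) (fst (snd t)) (snd (snd t)) \<in> W"
      then show "justified X W (prog_encode (ORec p q)) (prod_encode (a, 0)) v"
        unfolding justified_prog_encode by simp
    qed (use c in auto)
  next
    case (Suc n)
    then obtain u where u: "run X (ORec p q) (prod_encode (a, n)) = Some u"
      "run X q (prod_encode (a, prod_encode (n, u))) = Some v"
      by (auto simp: bind_eq_Some_conv)
    have c: "certified X (ORec p q) (prod_encode (a, n)) u"
      "certified X q (prod_encode (a, prod_encode (n, u))) v"
      using Suc.IH[OF u(1)] ORec.IH(2)[OF u(2)] by blast+
    show ?case
    proof (rule certifiedI[of "{(ORec p q, prod_encode (a, n), u), (q, prod_encode (a, prod_encode (n, u)), v)}"])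
      fix W
      assume "\<forall>t\<in>{(ORec p q, prod_encode (a, n), u), (q, prod_encode (a, prod_encode (n, u)), v)}.
        triple (prog_encode (fst t)) (fst (snd t)) (snd (snd t)) \<in> W"
      then have "triple (prog_encode (ORec p q)) (prod_encode (a, n)) u \<in> W"
        "triple (prog_encode q) (prod_encode (a, prod_encode (n, u))) v \<in> W"
        by simp_all
      then show "justified X W (prog_encode (ORec p q)) (prod_encode (a, Suc n)) v"
        unfolding justified_prog_encode by blast
    qed (use c in auto)
  qed
  from this[of "fst (prod_decode x)" "snd (prod_decode x)"] show ?case
    using ORec.prems by (simp del: run.simps)
next
  case (OMin p)
  define Q where "Q n \<longleftrightarrow> run X p (prod_encode (x, n)) = Some 0" for n
  from OMin.prems obtain n where n: "Q n" "\<forall>m<n. run X p (prod_encode (x, m)) \<noteq> None"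
    and v: "v = (LEAST n. Q n)"
    by (auto simp: Q_def split: if_splits)
  have 0: "Q v" unfolding v by (rule LeastI) (rule n)
  \<comment> \<open>The value at \<open>m\<close> is nonzero because \<open>v\<close> is the least
    zero, and defined because \<open>v \<le> n\<close>.\<close>
  have "\<exists>u. run X p (prod_encode (x, m)) = Some (Suc u)" if "m < v" for m
  proof -
    have "\<not> Q m" using that not_less_Least unfolding v by blast
    moreover have "m < n" using that Least_le[of Q n] n unfolding v by linarith
    ultimately show ?thesis using n(2) unfolding Q_def
      by (metis not0_implies_Suc option.exhaust)
  qed
  then obtain u where u: "\<And>m. m < v \<Longrightarrow> run X p (prod_encode (x, m)) = Some (Suc (u m))"
    by metis
  show ?case
    by (rule certifiedI[of "insert (p, prod_encode (x, v), 0) ((\<lambda>m. (p, prod_encode (x, m), Suc (u m))) ` {..<v})"])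
      (use 0 u OMin.IH in \<open>auto simp: justified_prog_encode Q_def simp del: prog_encode.simps\<close>)
qed (rule certifiedI[of "{}"]; simp add: justified_prog_encode del: prog_encode.simps)+

section \<open>The jump as an existential statement, and the use principle\<close>

definition halting_certificate :: "nat set \<Rightarrow> nat \<Rightarrow> nat \<Rightarrow> bool" where
  "halting_certificate X e w \<longleftrightarrow>
     certificate X (set_decode w) \<and> (\<exists>v<w. triple e e v \<in> set_decode w)"

lemma triple_in_set_decode_less:
  assumes "triple e x v \<in> set_decode w"
  shows "e < w" "x < w" "v < w"
  using triple_ge[of e x v] triple_ge(2)[of x e v] triple_ge(3)[of v e x] in_set_decode_less[OF assms]
  by linarith+

text \<open>This plays the part of Kleene's normal form, with codes of certificates in place of
  computation histories.\<close>

lemma turing_jump_iff: "e \<in> turing_jump X \<longleftrightarrow> (\<exists>w. halting_certificate X e w)"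
proof -
  obtain P where P: "e = prog_encode P" using surj_prog_encode by (rule surjE)
  have "e \<in> turing_jump X \<longleftrightarrow> (\<exists>v. run X P e = Some v)"
    by (simp add: turing_jump_def phi_def P inv_f_f[OF inj_prog_encode])
  also have "\<dots> \<longleftrightarrow> (\<exists>w. halting_certificate X e w)"
  proof
    assume "\<exists>v. run X P e = Some v"
    then obtain v where "run X P e = Some v" ..
    from certificate_complete[OF this] obtain W
      where W: "finite W" "certificate X W" "triple e e v \<in> W"
      unfolding certified_def P by (elim exE conjE)
    then have "set_decode (set_encode W) = W" by simp
    with W have t: "triple e e v \<in> set_decode (set_encode W)"
      and "certificate X (set_decode (set_encode W))" by simp_all
    moreover note triple_in_set_decode_less(3)[OF t]
    ultimately have "halting_certificate X e (set_encode W)"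
      unfolding halting_certificate_def by (intro conjI exI)
    then show "\<exists>w. halting_certificate X e w" ..
  next
    assume "\<exists>w. halting_certificate X e w"
    then obtain v w where "certificate X (set_decode w)" "triple (prog_encode P) e v \<in> set_decode w"
      unfolding halting_certificate_def P by (elim exE conjE)
    then show "\<exists>v. run X P e = Some v"
      using certificate_sound by (intro exI)
  qed
  finally show ?thesis .
qed

text \<open>This is the use principle: every query recorded in the certificate coded by
  \<open>w\<close> concerns a number below \<open>w\<close>.\<close>

lemma halting_certificate_cong:
  assumes "X \<inter> {..<w} = Y \<inter> {..<w}"
  shows "halting_certificate X e w \<longleftrightarrow> halting_certificate Y e w"
proof -
  have "justified X (set_decode w) e x v \<longleftrightarrow> justified Y (set_decode w) e x v"
    if "triple e x v \<in> set_decode w" for e x v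
  proof -
    have "x \<in> X \<longleftrightarrow> x \<in> Y"
      using triple_in_set_decode_less(2)[OF that] assms by blast
    then show ?thesis unfolding justified_def by simp
  qed
  then have "certificate X (set_decode w) \<longleftrightarrow> certificate Y (set_decode w)"
    unfolding certificate_def by metis
  then show ?thesis unfolding halting_certificate_def by simp
qed

section \<open>Decidability of certificates\<close>

lemma ex_bounded:
  fixes w :: nat
  assumes "\<And>p. Q p \<Longrightarrow> p < w" "\<And>p. P p \<longleftrightarrow> Q p"
  shows "(\<exists>p. P p) \<longleftrightarrow> (\<exists>p<w. Q p)"
  using assms by blast

text \<open>Each witness in \<open>justified\<close> is bounded by \<open>w\<close>, which brings
  the clauses into the form covered by the closure rules for decidable predicates.\<close>

definition justified_below :: "nat set \<Rightarrow> nat \<Rightarrow> nat \<Rightarrow> nat \<Rightarrow> nat \<Rightarrow> bool" where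
  "justified_below X w e x v \<longleftrightarrow>
     e = 0 \<and> v = 0 \<or>
     e = 1 \<and> v = Suc x \<or>
     e = 2 \<and> v = fst (prod_decode x) \<or>
     e = 3 \<and> v = snd (prod_decode x) \<or>
     e = 4 \<and> v = of_bool (x \<in> X) \<or>
     (\<exists>p<w. \<exists>q<w. \<exists>u<w. \<exists>u'<w. e = 5 + 4 * prod_encode (p, q) \<and> v = prod_encode (u, u') \<and>
        triple p x u \<in> set_decode w \<and> triple q x u' \<in> set_decode w) \<or>
     (\<exists>p<w. \<exists>q<w. \<exists>u<w. e = 6 + 4 * prod_encode (p, q) \<and> triple q x u \<in> set_decode w \<and> triple p u v \<in> set_decode w) \<or>
     (\<exists>p<w. \<exists>q<w. \<exists>a<w. e = 7 + 4 * prod_encode (p, q) \<and> x = prod_encode (a, 0) \<and> triple p a v \<in> set_decode w) \<or>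
     (\<exists>p<w. \<exists>q<w. \<exists>a<w. \<exists>m<w. \<exists>u<w. e = 7 + 4 * prod_encode (p, q) \<and> x = prod_encode (a, Suc m) \<and>
        triple e (prod_encode (a, m)) u \<in> set_decode w \<and>
        triple q (prod_encode (a, prod_encode (m, u))) v \<in> set_decode w) \<or>
     (\<exists>p<w. e = 8 + 4 * p \<and> triple p (prod_encode (x, v)) 0 \<in> set_decode w \<and>
        (\<forall>m<v. \<exists>u<w. triple p (prod_encode (x, m)) (Suc u) \<in> set_decode w))"

text \<open>The entries of a triple in \<open>set_decode w\<close> are below \<open>w\<close>, and a
  pair is at least as large as its components; hence every witness extracted from \<open>e\<close>,
  from \<open>x\<close> or from another triple is below \<open>w\<close>.\<close>

lemma justified_iff_below:
  assumes "triple e x v \<in> set_decode w"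
  shows "justified X (set_decode w) e x v \<longleftrightarrow> justified_below X w e x v"
proof -
  note less = triple_in_set_decode_less
  have c: "p < w" "q < w" if "e = k + 4 * prod_encode (p, q)" for p q k
    using le_prod_encode_1[of p q] le_prod_encode_2[of q p] less(1)[OF assms] that by linarith+
  have x: "a < w" "m < w" if "x = prod_encode (a, Suc m)" for a m
    using le_prod_encode_1[of a "Suc m"] le_prod_encode_2[of "Suc m" a] less(2)[OF assms] that
    by linarith+
  have p: "p < w" if "e = 8 + 4 * p" for p
    using less(1)[OF assms] that by linarith
  have u: "u < w" if "triple p y (Suc u) \<in> set_decode w" for p y u
    using less(3)[OF that] by linarith
  have 5: "(\<exists>p q u u'. e = 5 + 4 * prod_encode (p, q) \<and> v = prod_encode (u, u') \<and>
        triple p x u \<in> set_decode w \<and> triple q x u' \<in> set_decode w) \<longleftrightarrow>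
     (\<exists>p<w. \<exists>q<w. \<exists>u<w. \<exists>u'<w. e = 5 + 4 * prod_encode (p, q) \<and> v = prod_encode (u, u') \<and>
        triple p x u \<in> set_decode w \<and> triple q x u' \<in> set_decode w)"
    by (intro ex_bounded refl all_cong; elim exE conjE; (erule c x | erule less))
  have 6: "(\<exists>p q u. e = 6 + 4 * prod_encode (p, q) \<and> triple q x u \<in> set_decode w \<and> triple p u v \<in> set_decode w) \<longleftrightarrow>
     (\<exists>p<w. \<exists>q<w. \<exists>u<w. e = 6 + 4 * prod_encode (p, q) \<and> triple q x u \<in> set_decode w \<and> triple p u v \<in> set_decode w)"
    by (intro ex_bounded refl all_cong; elim exE conjE; (erule c x | erule less))
  have 7: "(\<exists>p q a. e = 7 + 4 * prod_encode (p, q) \<and> x = prod_encode (a, 0) \<and> triple p a v \<in> set_decode w) \<longleftrightarrow>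
     (\<exists>p<w. \<exists>q<w. \<exists>a<w. e = 7 + 4 * prod_encode (p, q) \<and> x = prod_encode (a, 0) \<and> triple p a v \<in> set_decode w)"
    by (intro ex_bounded refl all_cong; elim exE conjE; (erule c x | erule less))
  have 8: "(\<exists>p q a m u. e = 7 + 4 * prod_encode (p, q) \<and> x = prod_encode (a, Suc m) \<and>
        triple e (prod_encode (a, m)) u \<in> set_decode w \<and>
        triple q (prod_encode (a, prod_encode (m, u))) v \<in> set_decode w) \<longleftrightarrow>
     (\<exists>p<w. \<exists>q<w. \<exists>a<w. \<exists>m<w. \<exists>u<w. e = 7 + 4 * prod_encode (p, q) \<and> x = prod_encode (a, Suc m) \<and>
        triple e (prod_encode (a, m)) u \<in> set_decode w \<and>
        triple q (prod_encode (a, prod_encode (m, u))) v \<in> set_decode w)"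
    by (intro ex_bounded refl all_cong; elim exE conjE; (erule c x | erule less))
  have u': "(\<exists>u. triple p y (Suc u) \<in> set_decode w) \<longleftrightarrow> (\<exists>u<w. triple p y (Suc u) \<in> set_decode w)" for p y
    by (intro ex_bounded refl; erule u)
  have 9: "(\<exists>p. e = 8 + 4 * p \<and> triple p (prod_encode (x, v)) 0 \<in> set_decode w \<and>
        (\<forall>m<v. \<exists>u. triple p (prod_encode (x, m)) (Suc u) \<in> set_decode w)) \<longleftrightarrow>
     (\<exists>p<w. e = 8 + 4 * p \<and> triple p (prod_encode (x, v)) 0 \<in> set_decode w \<and>
        (\<forall>m<v. \<exists>u<w. triple p (prod_encode (x, m)) (Suc u) \<in> set_decode w))"
    unfolding u' by (intro ex_bounded refl; elim exE conjE; erule p)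
  show ?thesis unfolding justified_def justified_below_def by (simp only: 5 6 7 8 9)
qed

lemma certificate_bounded:
  "certificate X (set_decode w) \<longleftrightarrow>
     (\<forall>e<w. \<forall>x<w. \<forall>v<w. triple e x v \<in> set_decode w \<longrightarrow> justified_below X w e x v)"
  unfolding certificate_def
proof (intro iffI allI impI)
  fix e x v
  assume *: "\<forall>e<w. \<forall>x<w. \<forall>v<w. triple e x v \<in> set_decode w \<longrightarrow> justified_below X w e x v"
    and t: "triple e x v \<in> set_decode w"
  with triple_in_set_decode_less[OF t] have "justified_below X w e x v" by simp
  with justified_iff_below[OF t] show "justified X (set_decode w) e x v" by simp
qed (use justified_iff_below in simp)

text \<open>The oracle is a uniformly decidable family \<open>Y\<close>, because in the tree each
  node carries its own finite approximation of the oracle.\<close>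

lemma dec_halting_certificate:
  assumes Y: "dec Z (\<lambda>z. snd (prod_decode z) \<in> Y (fst (prod_decode z)))"
    and y: "computable_in Z y" and e: "computable_in Z e" and w: "computable_in Z w"
  shows "dec Z (\<lambda>z. halting_certificate (Y (y z)) (e z) (w z))"
proof -
  note in_Y = dec_compose2[where P = "\<lambda>a b. b \<in> Y a", OF Y]
  show ?thesis
    unfolding halting_certificate_def certificate_bounded justified_below_def triple_def
    by (intro comp_intros in_Y comp_compose[OF y] comp_compose[OF e] comp_compose[OF w])
qed

text \<open>Halting relative to \<open>A\<close> asks for a certificate, and certificates relative
  to \<open>A\<close> are decidable in \<open>B\<close>; one jump of \<open>B\<close> answers the
  existential question.\<close>

lemma turing_jump_mono:
  assumes "A \<le>\<^sub>T B"
  shows "turing_jump A \<le>\<^sub>T turing_jump B"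
  unfolding turing_le_iff_dec turing_jump_iff
  by (intro dec_ex_turing_jump dec_halting_certificate[where Y = "\<lambda>_. A" and y = "\<lambda>_. 0"]
      comp_intros dec_turing_le[OF assms])


section \<open>The Erdos-Rado tree\<close>

text \<open>Every sequence has a subsequence along which a given \<open>f n\<close> is constant, as
  \<open>f n\<close> has finite range; diagonalisation treats all \<open>n\<close> together.\<close>

lemma ex_stable_subsequence:
  fixes f :: "nat \<Rightarrow> nat \<Rightarrow> 'a"
  assumes fin: "\<And>n. finite (range (f n))"
  shows "\<exists>r. strict_mono r \<and> (\<forall>n. \<exists>v. \<forall>\<^sub>F m in sequentially. f n (r m) = v)"
proof -
  define P where "P n s \<longleftrightarrow> (\<exists>v. \<forall>\<^sub>F m in sequentially. f n (s m) = v)" for n and s :: "nat \<Rightarrow> nat"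
  interpret subseqs P
  proof
    fix n and s :: "nat \<Rightarrow> nat"
    have "finite (range (\<lambda>m. f n (s m)))"
      by (rule finite_subset[OF _ fin[of n]]) auto
    from pigeonhole_infinite[OF infinite_UNIV_nat this]
    obtain m0 where "infinite {m. f n (s m) = f n (s m0)}" by auto
    from infinite_enumerate[OF this]
    obtain r :: "nat \<Rightarrow> nat" where "strict_mono r" "\<forall>m. f n (s (r m)) = f n (s m0)"
      by auto
    then show "\<exists>r. strict_mono r \<and> P n (s \<circ> r)"
      unfolding P_def by auto
  qed
  have "P n diagseq" for n
  proof -
    \<comment> \<open>The diagonal sequence is a subsequence of the \<open>n\<close>-th one only
      from index \<open>Suc n\<close> on; the shift is harmless for a statement about almost all
      indices.\<close>
    have "P n (diagseq \<circ> (+) (Suc n))"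
    proof (rule diagseq_holds)
      fix r s :: "nat \<Rightarrow> nat" and n
      assume r: "strict_mono r" and "P n s"
      then obtain v where "\<forall>\<^sub>F m in sequentially. f n (s m) = v"
        unfolding P_def by blast
      then have "\<forall>\<^sub>F m in sequentially. f n (s (r m)) = v"
        by (rule eventually_subseq[OF r])
      then show "P n (s \<circ> r)" unfolding P_def by auto
    qed
    then obtain v where "\<forall>\<^sub>F m in sequentially. f n (diagseq (m + Suc n)) = v"
      using P_def[of n "diagseq \<circ> (+) (Suc n)"] by (auto simp: add.commute)
    then have "\<forall>\<^sub>F m in sequentially. f n (diagseq m) = v"
      using eventually_sequentially_seg[of "\<lambda>m. f n (diagseq m) = v" "Suc n"] by blast
    then show ?thesis
      using P_def[of n diagseq] by blast
  qed
  then have "\<forall>n. \<exists>v. \<forall>\<^sub>F m in sequentially. f n (diagseq m) = v"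
    using P_def[of _ diagseq] by blast
  with subseq_diagseq show ?thesis by blast
qed

text \<open>
  The predecessors of \<open>y\<close> in the tree are chosen greedily so that, above every
  set of earlier predecessors, they all behave like \<open>y\<close>.
\<close>

primrec preds_below :: "nat set \<Rightarrow> (nat set \<Rightarrow> nat) \<Rightarrow> nat \<Rightarrow> nat \<Rightarrow> nat set" where
  "preds_below A C y 0 = {}"
| "preds_below A C y (Suc k) =
     (if k \<in> A \<and> (\<forall>S\<subseteq>preds_below A C y k. C (insert k S) = C (insert y S))
      then insert k (preds_below A C y k) else preds_below A C y k)"

abbreviation preds :: "nat set \<Rightarrow> (nat set \<Rightarrow> nat) \<Rightarrow> nat \<Rightarrow> nat set" where
  "preds A C y \<equiv> preds_below A C y y"

lemma preds_below_subset: "preds_below A C y k \<subseteq> A \<inter> {..<k}"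
  by (induction k) (auto simp: less_Suc_eq)

lemma finite_preds_below: "finite (preds_below A C y k)"
  by (rule finite_subset[of _ "{..<k}"]) (use preds_below_subset in auto)

lemma preds_below_restrict:
  "j \<le> k \<Longrightarrow> preds_below A C y j = preds_below A C y k \<inter> {..<j}"
proof (induction k)
  case (Suc k)
  then show ?case
  proof (cases "j = Suc k")
    case True
    then show ?thesis using preds_below_subset[of A C y "Suc k"] by blast
  next
    case False
    then show ?thesis using Suc by auto
  qed
qed simp

lemma in_preds_below_iff:
  assumes "x < k"
  shows "x \<in> preds_below A C y k \<longleftrightarrow>
    x \<in> A \<and> (\<forall>S\<subseteq>preds_below A C y x. C (insert x S) = C (insert y S))"
proof -
  have "x \<notin> preds_below A C y x" using preds_below_subset by blast
  then have "x \<in> preds_below A C y (Suc x) \<longleftrightarrow>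
    x \<in> A \<and> (\<forall>S\<subseteq>preds_below A C y x. C (insert x S) = C (insert y S))"
    by simp
  moreover have "preds_below A C y (Suc x) = preds_below A C y k \<inter> {..<Suc x}"
    using assms by (intro preds_below_restrict) simp
  ultimately show ?thesis by auto
qed

text \<open>A predecessor \<open>x\<close> of \<open>y\<close> gives the same colors as
  \<open>y\<close> above all sets of earlier predecessors, so the greedy test at each earlier stage
  has the same outcome for both. This coherence makes the relation a tree order.\<close>

lemma preds_below_coherent:
  assumes "x \<in> preds_below A C y k" "j \<le> x"
  shows "preds_below A C x j = preds_below A C y j"
  using \<open>j \<le> x\<close>
proof (induction j)
  case (Suc j)
  have "x < k" using assms(1) preds_below_subset by blast
  have "preds_below A C y j \<subseteq> preds_below A C y x"
    using preds_below_restrict[of j x A C y] Suc.prems by auto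
  moreover have "\<forall>S\<subseteq>preds_below A C y x. C (insert x S) = C (insert y S)"
    using assms(1) in_preds_below_iff[OF \<open>x < k\<close>] by blast
  ultimately have "\<forall>S\<subseteq>preds_below A C y j. C (insert x S) = C (insert y S)"
    by (meson subset_trans)
  then have "(\<forall>S\<subseteq>preds_below A C y j. C (insert j S) = C (insert x S)) \<longleftrightarrow>
    (\<forall>S\<subseteq>preds_below A C y j. C (insert j S) = C (insert y S))"
    by metis
  moreover have "preds_below A C x j = preds_below A C y j" using Suc by simp
  ultimately show ?case by (simp only: preds_below.simps)
qed simp

lemma preds_of_pred:
  assumes "x \<in> preds A C y"
  shows "preds A C x = preds A C y \<inter> {..<x}"
proof -
  have "x < y" using assms preds_below_subset by blast
  then show ?thesis
    using preds_below_coherent[OF assms order_refl] preds_below_restrict[of x y A C y] by simp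
qed

text \<open>The path is obtained as a limit instead of by choosing children one at a time. Nodes
  \<open>z m\<close> run through the shrinking subtrees so that each color
  \<open>C (insert (z m) T)\<close> with \<open>T\<close> finite is eventually constant. Each greedy
  decision depends on finitely many such colors, so the predecessor sets of \<open>z m\<close>
  converge; \<open>B\<close> is their limit. Closure of the subtrees under predecessors puts
  \<open>B\<close> into all of them.\<close>

theorem ex_path_through_subtrees:
  fixes S :: "nat \<Rightarrow> nat set" and C :: "nat set \<Rightarrow> nat"
  assumes fin: "finite (range C)"
    and inf: "\<And>m. infinite (S m)" and dec: "\<And>m. S (Suc m) \<subseteq> S m" and S0: "S 0 \<subseteq> A"
    and down: "\<And>m x y. y \<in> S m \<Longrightarrow> x \<in> preds A C y \<Longrightarrow> x \<in> S m"
  shows "\<exists>B. infinite B \<and> (\<forall>m. B \<subseteq> S m) \<and> (\<forall>y\<in>B. preds A C y = B \<inter> {..<y})"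
proof -
  have S_mono: "S n \<subseteq> S m" if "m \<le> n" for m n
    using that dec by (metis lift_Suc_antimono_le)
  have "\<exists>y>m. y \<in> S m" for m
    using inf[of m] unfolding infinite_nat_iff_unbounded by blast
  then have "\<forall>m. \<exists>y>m. y \<in> S m" by blast
  from choice[OF this] obtain y where y: "\<And>m. m < y m" "\<And>m. y m \<in> S m" by blast
  have "finite (range (\<lambda>m. C (insert (y m) (set_decode n))))" for n
    by (rule finite_subset[OF _ fin]) auto
  from ex_stable_subsequence[of "\<lambda>n m. C (insert (y m) (set_decode n))", OF this]
  obtain r where r: "strict_mono r"
    and stable: "\<And>n. \<exists>v. \<forall>\<^sub>F m in sequentially. C (insert (y (r m)) (set_decode n)) = v"
    by auto
  define z where "z m = y (r m)" for m
  have z_gt: "m < z m" for m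
    using y(1)[of "r m"] seq_suble[OF r, of m] unfolding z_def by linarith
  have z_ev: "\<forall>\<^sub>F m in sequentially. k < z m" for k
    using eventually_gt_at_top[of k] by eventually_elim (use z_gt in \<open>meson less_trans\<close>)
  have z_S: "\<forall>\<^sub>F m in sequentially. z m \<in> S n" for n
    using eventually_ge_at_top[of n]
  proof eventually_elim
    case (elim m)
    then have "n \<le> r m" using seq_suble[OF r, of m] by linarith
    then show ?case using y(2) S_mono unfolding z_def by blast
  qed
  define d where "d T = (SOME v. \<forall>\<^sub>F m in sequentially. C (insert (z m) T) = v)" for T
  have d: "\<forall>\<^sub>F m in sequentially. C (insert (z m) T) = d T" if "finite T" for T
  proof -
    have "\<exists>v. \<forall>\<^sub>F m in sequentially. C (insert (z m) T) = v"
      using stable[of "set_encode T"] that unfolding z_def by simp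
    then show ?thesis unfolding d_def by (rule someI_ex)
  qed
  have d_all: "\<forall>\<^sub>F m in sequentially. \<forall>T\<subseteq>F. C (insert (z m) T) = d T" if "finite F" for F
  proof -
    have "\<forall>\<^sub>F m in sequentially. \<forall>T\<in>Pow F. C (insert (z m) T) = d T"
      using that d by (intro eventually_ball_finite) (auto intro: finite_subset)
    then show ?thesis by (simp add: Ball_def)
  qed
  define B where "B = {x. \<forall>\<^sub>F m in sequentially. x \<in> preds A C (z m)}"
  have below: "\<forall>\<^sub>F m in sequentially. preds_below A C (z m) k = B \<inter> {..<k}" for k
  proof -
    have "\<exists>F. \<forall>\<^sub>F m in sequentially. preds_below A C (z m) k = F"
    proof (induction k)
      case (Suc k)
      then obtain F where F: "\<forall>\<^sub>F m in sequentially. preds_below A C (z m) k = F" by blast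
      from eventually_happens'[OF sequentially_bot F] have "finite F"
        using finite_preds_below by blast
      from F d_all[OF this] have "\<forall>\<^sub>F m in sequentially. preds_below A C (z m) (Suc k) =
        (if k \<in> A \<and> (\<forall>T\<subseteq>F. C (insert k T) = d T) then insert k F else F)"
      proof eventually_elim
        case (elim m)
        then have "(\<forall>T\<subseteq>F. C (insert k T) = C (insert (z m) T)) \<longleftrightarrow> (\<forall>T\<subseteq>F. C (insert k T) = d T)"
          by metis
        then show ?case by (simp only: preds_below.simps elim(1))
      qed
      then show ?case by (rule exI)
    qed simp
    then obtain F where F: "\<forall>\<^sub>F m in sequentially. preds_below A C (z m) k = F" by blast
    from eventually_happens'[OF sequentially_bot F] have F_sub: "F \<subseteq> {..<k}"
      using preds_below_subset by blast
    have F': "\<forall>\<^sub>F m in sequentially. preds A C (z m) \<inter> {..<k} = F"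
      using F z_ev[of k]
    proof eventually_elim
      case (elim m)
      then show ?case using preds_below_restrict[of k "z m" A C "z m"] by simp
    qed
    have "x \<in> F \<longleftrightarrow> x \<in> B" if "x < k" for x
    proof
      assume "x \<in> F"
      from F' have "\<forall>\<^sub>F m in sequentially. x \<in> preds A C (z m)"
        by eventually_elim (use \<open>x \<in> F\<close> in blast)
      then show "x \<in> B" by (simp add: B_def)
    next
      assume "x \<in> B"
      then have "\<forall>\<^sub>F m in sequentially. x \<in> preds A C (z m)" by (simp add: B_def)
      with F' have "\<forall>\<^sub>F m in sequentially. x \<in> F"
        by eventually_elim (use that in blast)
      then show "x \<in> F" by simp
    qed
    with F_sub have "F = B \<inter> {..<k}" by blast
    with F show ?thesis by simp
  qed
  have "B \<subseteq> S m" for m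
  proof
    fix x
    assume "x \<in> B"
    then have "\<forall>\<^sub>F m in sequentially. x \<in> preds A C (z m)" unfolding B_def by simp
    with z_S[of m] have "\<forall>\<^sub>F i in sequentially. x \<in> S m"
      by eventually_elim (rule down)
    then show "x \<in> S m" by simp
  qed
  moreover have "preds A C x = B \<inter> {..<x}" if "x \<in> B" for x
  proof -
    from that have "\<forall>\<^sub>F m in sequentially. x \<in> preds A C (z m)" unfolding B_def by simp
    with below[of x] have "\<forall>\<^sub>F m in sequentially. preds A C x = B \<inter> {..<x}"
      by eventually_elim (simp add: preds_below_coherent)
    then show ?thesis by simp
  qed
  moreover have "infinite B"
    unfolding infinite_nat_iff_unbounded_le
  proof
    fix k
    define F where "F = B \<inter> {..<k}"
    \<comment> \<open>\<open>G\<close> contains the numbers from \<open>k\<close> on that continue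
      the path and show the limit colors above \<open>F\<close>. Its least element \<open>x\<close>
      becomes a predecessor of almost all \<open>z m\<close>: any number in between that was
      selected would itself belong to \<open>G\<close>.\<close>
    define G where "G = {x \<in> A. k \<le> x \<and> preds_below A C x k = F \<and> (\<forall>T\<subseteq>F. C (insert x T) = d T)}"
    have good: "\<forall>\<^sub>F m in sequentially. preds_below A C (z m) k = F \<and> (\<forall>T\<subseteq>F. C (insert (z m) T) = d T)"
      using below[of k] d_all[of F] by (auto simp: F_def intro: eventually_conj)
    with z_ev[of k] z_S[of 0] have "\<forall>\<^sub>F m in sequentially. z m \<in> G"
      by eventually_elim (use S0 in \<open>auto simp: G_def\<close>)
    from eventually_happens'[OF sequentially_bot this] obtain i where "z i \<in> G" ..
    then have x: "(LEAST x. x \<in> G) \<in> G" by (rule LeastI)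
    define x where "x = (LEAST x. x \<in> G)"
    note x = x[folded x_def]
    have x_least: "j \<notin> G" if "j < x" for j
      using that not_less_Least unfolding x_def by blast
    have "\<forall>\<^sub>F m in sequentially. x \<in> preds A C (z m)"
      using good z_ev[of x]
    proof eventually_elim
      case (elim m)
      have "preds_below A C (z m) j = F" if "k \<le> j" "j \<le> x" for j
        using that
      proof (induction j rule: dec_induct)
        case (step j)
        have "j \<notin> preds_below A C (z m) (Suc j)"
        proof
          assume j: "j \<in> preds_below A C (z m) (Suc j)"
          then have "j \<in> A" "\<forall>T\<subseteq>F. C (insert j T) = d T"
            using in_preds_below_iff[of j "Suc j" A C "z m"] step elim by auto
          moreover have "preds_below A C j k = F"
            using preds_below_coherent[OF j \<open>k \<le> j\<close>] elim by simp
          ultimately have "j \<in> G" using \<open>k \<le> j\<close> unfolding G_def by blast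
          with x_least[of j] step.prems show False by simp
        qed
        with step show ?case by (auto split: if_splits)
      qed (use elim in simp)
      from this[of x] have "preds_below A C (z m) x = F" using x by (simp add: G_def)
      with elim x show ?case
        by (subst in_preds_below_iff) (auto simp: G_def)
    qed
    then have "x \<in> B" unfolding B_def by simp
    then show "\<exists>n\<ge>k. n \<in> B" using x unfolding G_def by blast
  qed
  ultimately show ?thesis by blast
qed


section \<open>End-homogeneous sets with low jump\<close>

definition join :: "nat set \<Rightarrow> nat set \<Rightarrow> nat set" where
  "join A B = {z. \<exists>x. z = 2 * x \<and> x \<in> A \<or> z = Suc (2 * x) \<and> x \<in> B}"

lemma in_join_iff:
  "z \<in> join A B \<longleftrightarrow> (\<exists>x<Suc z. z = 2 * x \<and> x \<in> A \<or> z = Suc (2 * x) \<and> x \<in> B)"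
  unfolding join_def mem_Collect_eq by (rule ex_bounded) auto

lemma in_join_simps [simp]: "2 * x \<in> join A B \<longleftrightarrow> x \<in> A" "Suc (2 * x) \<in> join A B \<longleftrightarrow> x \<in> B"
  unfolding join_def by (auto; presburger)+

lemma turing_le_join: "A \<le>\<^sub>T join A B" "B \<le>\<^sub>T join A B"
proof -
  have "dec (join A B) (\<lambda>x. 2 * x \<in> join A B)" "dec (join A B) (\<lambda>x. Suc (2 * x) \<in> join A B)"
    by (intro dec_oracle comp_intros)+
  then show "A \<le>\<^sub>T join A B" "B \<le>\<^sub>T join A B"
    by (simp_all add: turing_le_iff_dec)
qed

text \<open>An element of a join is at least as large as the number it encodes, so below
  \<open>y\<close> only the part of \<open>A\<close> below \<open>y\<close> is visible.\<close>

lemma join_agree: "join (A \<inter> {..<y}) X \<inter> {..<y} = join A X \<inter> {..<y}"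
  unfolding join_def by auto

lemma agree_below:
  fixes A B :: "nat set"
  assumes "A \<inter> {..<y} = B \<inter> {..<y}" "w \<le> y"
  shows "A \<inter> {..<w} = B \<inter> {..<w}"
proof -
  have "A \<inter> {..<w} = (A \<inter> {..<y}) \<inter> {..<w}" "B \<inter> {..<w} = (B \<inter> {..<y}) \<inter> {..<w}"
    using assms(2) by auto
  with assms(1) show ?thesis by (simp only:)
qed

text \<open>Also called pre-homogeneity. Here \<open>S\<close> may have any finite size, so one set
  serves all exponents simultaneously.\<close>

definition end_homogeneous :: "(nat \<Rightarrow> nat) \<Rightarrow> nat set \<Rightarrow> bool" where
  "end_homogeneous c B \<longleftrightarrow>
     (\<forall>x\<in>B. \<forall>y\<in>B. \<forall>S\<subseteq>B \<inter> {..<x}. x < y \<longrightarrow>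
        c (set_encode (insert x S)) = c (set_encode (insert y S)))"

context
  fixes X A :: "nat set" and c :: "nat \<Rightarrow> nat"
  assumes A: "A \<le>\<^sub>T X" and inf_A: "infinite A"
    and c: "computable_in X c" and fin_c: "finite (range c)"
begin

abbreviation (input) P :: "nat \<Rightarrow> nat set" where
  "P y \<equiv> preds A (\<lambda>S. c (set_encode S)) y"

text \<open>This is the greedy choice on codes: \<open>p\<close> codes the predecessors found so
  far, the numbers \<open>s < 2 ^ k\<close> code the subsets of \<open>{..<k}\<close>, and adding
  \<open>2 ^ k\<close> or \<open>2 ^ y\<close> inserts a new largest element.\<close>

definition preds_code :: "nat \<Rightarrow> nat \<Rightarrow> nat" where
  "preds_code y k = rec_nat 0 (\<lambda>k p. if k \<in> A \<and>
     (\<forall>s<2 ^ k. (\<forall>z<s. z \<in> set_decode s \<longrightarrow> z \<in> set_decode p) \<longrightarrow> c (s + 2 ^ k) = c (s + 2 ^ y))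
     then p + 2 ^ k else p) k"

lemma set_encode_less: "S \<subseteq> {..<k} \<Longrightarrow> set_encode S < 2 ^ k"
proof (induction k arbitrary: S)
  case (Suc k)
  have "finite S" using Suc.prems finite_subset by blast
  have "set_encode (S - {k}) < 2 ^ k" using Suc.prems by (intro Suc.IH) (auto simp: less_Suc_eq)
  moreover have "set_encode S \<le> 2 ^ k + set_encode (S - {k})"
    using set_encode_insert[of "S - {k}" k] \<open>finite S\<close> by (cases "k \<in> S") (simp_all add: insert_absorb)
  ultimately show ?case by simp
qed simp

lemma preds_code: "k \<le> y \<Longrightarrow> preds_code y k = set_encode (preds_below A (\<lambda>S. c (set_encode S)) y k)"
proof (induction k)
  case (Suc k)
  define Q where "Q = preds_below A (\<lambda>S. c (set_encode S)) y k"
  have Q: "Q \<subseteq> {..<k}" "finite Q"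
    unfolding Q_def using preds_below_subset finite_preds_below by blast+
  have IH: "preds_code y k = set_encode Q" using Suc unfolding Q_def by simp
  have ins: "set_encode (insert x S) = set_encode S + 2 ^ x" if "S \<subseteq> Q" "k \<le> x" for S x
    using that Q finite_subset[OF that(1)] by (subst set_encode_insert) auto
  have "(\<forall>s<2 ^ k. (\<forall>z<s. z \<in> set_decode s \<longrightarrow> z \<in> set_decode (set_encode Q)) \<longrightarrow> c (s + 2 ^ k) = c (s + 2 ^ y)) \<longleftrightarrow>
    (\<forall>S\<subseteq>Q. c (set_encode (insert k S)) = c (set_encode (insert y S)))"
  proof safe
    fix S
    assume *: "\<forall>s<2 ^ k. (\<forall>z<s. z \<in> set_decode s \<longrightarrow> z \<in> set_decode (set_encode Q)) \<longrightarrow> c (s + 2 ^ k) = c (s + 2 ^ y)"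
      and S: "S \<subseteq> Q"
    have "finite S" using S Q finite_subset by blast
    then have "set_encode S < 2 ^ k" "\<forall>z<set_encode S. z \<in> set_decode (set_encode S) \<longrightarrow> z \<in> set_decode (set_encode Q)"
      using S Q set_encode_less[of S k] by auto
    with * have "c (set_encode S + 2 ^ k) = c (set_encode S + 2 ^ y)" by blast
    then show "c (set_encode (insert k S)) = c (set_encode (insert y S))"
      using ins[OF S] Suc.prems by simp
  next
    fix s :: nat
    assume *: "\<forall>S\<subseteq>Q. c (set_encode (insert k S)) = c (set_encode (insert y S))"
      and s: "\<forall>z<s. z \<in> set_decode s \<longrightarrow> z \<in> set_decode (set_encode Q)"
    have "set_decode s \<subseteq> Q" using s in_set_decode_less Q by auto
    with * have "c (set_encode (insert k (set_decode s))) = c (set_encode (insert y (set_decode s)))"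
      by blast
    then show "c (s + 2 ^ k) = c (s + 2 ^ y)"
      using ins[OF \<open>set_decode s \<subseteq> Q\<close>] Suc.prems by simp
  qed
  then have "preds_code y (Suc k) =
    (if k \<in> A \<and> (\<forall>S\<subseteq>Q. c (set_encode (insert k S)) = c (set_encode (insert y S)))
     then set_encode Q + 2 ^ k else set_encode Q)"
    using IH unfolding preds_code_def by simp
  also have "\<dots> = set_encode (preds_below A (\<lambda>S. c (set_encode S)) y (Suc k))"
    using ins[of Q k] unfolding preds_below.simps Q_def[symmetric] by simp
  finally show ?case .
qed (simp add: preds_code_def)

lemma comp_preds_code:
  assumes "computable_in X f" "computable_in X g"
  shows "computable_in X (\<lambda>x. preds_code (f x) (g x))"
  unfolding preds_code_def
  by (intro comp_rec comp_intros assms dec_turing_le[OF A] comp_compose[OF c] comp_compose[OF assms(1)])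

text \<open>
  If \<open>y\<close> lies on a path \<open>B\<close>, the predecessors of \<open>y\<close> are the initial segment of \<open>B\<close> below \<open>y\<close>, so
  \<open>survives e y\<close> says that no \<open>w < y\<close> certifies the convergence of program \<open>e\<close> with oracle
  \<open>join B X\<close>. The nodes surviving for all \<open>e\<close> coded by \<open>d\<close> form a subtree.
\<close>

definition oracle_at :: "nat \<Rightarrow> nat set" where
  "oracle_at y = join (P y) X"

definition survives :: "nat \<Rightarrow> nat \<Rightarrow> bool" where
  "survives e y \<longleftrightarrow> \<not> (\<exists>w<y. halting_certificate (oracle_at y) e w)"

definition node :: "nat \<Rightarrow> nat \<Rightarrow> bool" where
  "node d y \<longleftrightarrow> y \<in> A \<and> (\<forall>e<d. e \<in> set_decode d \<longrightarrow> survives e y)"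

lemma dec_node: "dec X (\<lambda>z. node (fst (prod_decode z)) (snd (prod_decode z)))"
proof -
  have in_P: "z \<in> P y \<longleftrightarrow> z \<in> set_decode (preds_code y y)" for y z
    by (simp add: preds_code finite_preds_below)
  have "dec X (\<lambda>z. snd (prod_decode z) \<in> oracle_at (fst (prod_decode z)))"
    unfolding oracle_at_def in_join_iff in_P
    by (intro comp_intros comp_preds_code dec_oracle)
  note cert = dec_halting_certificate[where Y = oracle_at, OF this]
  show ?thesis
    unfolding node_def survives_def
    by (intro comp_intros cert dec_turing_le[OF A])
qed

definition wide :: "nat \<Rightarrow> bool" where
  "wide d \<longleftrightarrow> infinite {y. node d y}"

text \<open>Infinitude of a set decidable in \<open>X\<close> is a Pi_2 question, and each
  quantifier costs one jump. No computable bound on branching is at hand to lower it to Pi_1, as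
  compactness does in the usual low basis theorem.\<close>

lemma dec_wide: "dec (turing_jump (turing_jump X)) wide"
proof -
  have "dec X (\<lambda>z. snd (prod_decode (fst (prod_decode z))) < snd (prod_decode z) \<and>
      node (fst (prod_decode (fst (prod_decode z)))) (snd (prod_decode z)))"
    by (intro comp_intros dec_compose2[where P = node, OF dec_node])
  from dec_ex_turing_jump[where P = "\<lambda>z y. snd (prod_decode z) < y \<and> node (fst (prod_decode z)) y", OF this]
  have "dec (turing_jump X) (\<lambda>z. \<not> (\<exists>y. snd (prod_decode z) < y \<and> node (fst (prod_decode z)) y))"
    by (rule dec_not)
  from dec_ex_turing_jump[where P = "\<lambda>d m. \<not> (\<exists>y>m. node d y)", OF this]
  have "dec (turing_jump (turing_jump X)) (\<lambda>d. \<not> (\<exists>m. \<not> (\<exists>y>m. node d y)))"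
    by (rule dec_not)
  moreover have "wide = (\<lambda>d. \<not> (\<exists>m. \<not> (\<exists>y>m. node d y)))"
    by (rule ext) (simp add: wide_def infinite_nat_iff_unbounded)
  ultimately show ?thesis by (simp only:)
qed

text \<open>
  Program \<open>e\<close> is forced to diverge whenever the current subtree stays infinite; a path through
  all these subtrees has the complement of \<open>forced\<close> as its jump.
\<close>

definition forced_code :: "nat \<Rightarrow> nat" where
  "forced_code e = rec_nat 0 (\<lambda>e d. if wide (d + 2 ^ e) then d + 2 ^ e else d) e"

definition forced :: "nat set" where
  "forced = {e. wide (forced_code e + 2 ^ e)}"

lemma forced_code_Suc:
  "forced_code (Suc e) = (if e \<in> forced then forced_code e + 2 ^ e else forced_code e)"
  by (simp add: forced_code_def forced_def)

lemma dec_forced: "dec (turing_jump (turing_jump X)) (\<lambda>e. e \<in> forced)"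
proof -
  have "computable_in (turing_jump (turing_jump X)) forced_code"
    unfolding forced_code_def
    by (intro comp_rec comp_intros dec_compose[OF dec_wide])
  then show ?thesis
    unfolding forced_def mem_Collect_eq
    by (intro dec_compose[OF dec_wide] comp_intros)
qed

lemma set_decode_forced_code: "set_decode (forced_code e) = forced \<inter> {..<e}"
proof (induction e)
  case 0
  then show ?case by (simp add: forced_code_def)
next
  case (Suc e)
  note forced_code_Suc[of e]
  moreover have "set_decode (forced_code e + 2 ^ e) = insert e (set_decode (forced_code e))"
    using set_decode_plus_power_2[of e "forced_code e"] Suc by (simp only: add.commute) simp
  moreover have "forced \<inter> {..<Suc e} =
    (if e \<in> forced then insert e (forced \<inter> {..<e}) else forced \<inter> {..<e})"
    unfolding lessThan_Suc by simp
  ultimately show ?case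
    by (simp only: Suc if_distrib[of set_decode])
qed

lemma node_iff: "node d y \<longleftrightarrow> y \<in> A \<and> (\<forall>e\<in>set_decode d. survives e y)"
  unfolding node_def using in_set_decode_less[of _ d] by blast

text \<open>The oracles at \<open>x\<close> and \<open>y\<close> agree below \<open>x\<close>, so by
  the use principle a certificate found at \<open>x\<close> would also count at \<open>y\<close>.
  Hence the surviving nodes form a subtree, as the path theorem requires.\<close>

lemma survives_down:
  assumes "survives e y" "x \<in> P y"
  shows "survives e x"
proof -
  have "x < y" using assms(2) preds_below_subset by blast
  have "halting_certificate (oracle_at x) e w \<longleftrightarrow> halting_certificate (oracle_at y) e w" if "w < x" for w
  proof (rule halting_certificate_cong)
    have "oracle_at x \<inter> {..<x} = oracle_at y \<inter> {..<x}"
      unfolding oracle_at_def preds_of_pred[OF assms(2)] by (rule join_agree)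
    then show "oracle_at x \<inter> {..<w} = oracle_at y \<inter> {..<w}"
      by (rule agree_below) (use that in simp)
  qed
  with assms(1) \<open>x < y\<close> show ?thesis unfolding survives_def by (meson less_trans)
qed

text \<open>The witness for \<open>Y\<close> is \<open>join B X\<close>. Controlling the jump of the
  join, and not only that of \<open>B\<close>, allows iteration: the next coloring is computed from
  \<open>B\<close> together with the old coloring.\<close>

theorem ex_end_homogeneous:
  "\<exists>B Y. infinite B \<and> B \<subseteq> A \<and> B \<le>\<^sub>T Y \<and> X \<le>\<^sub>T Y \<and>
     turing_jump Y \<le>\<^sub>T turing_jump (turing_jump X) \<and> end_homogeneous c B"
proof -
  define S where "S m = {y. node (forced_code m) y}" for m
  have S: "S m = {y\<in>A. \<forall>e\<in>forced \<inter> {..<m}. survives e y}" for m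
    unfolding S_def node_iff set_decode_forced_code ..
  have inf_S: "infinite (S m)" for m
  proof (induction m)
    case 0
    then show ?case using inf_A by (simp add: S)
  next
    case (Suc m)
    show ?case
    proof (cases "m \<in> forced")
      case True
      then have "wide (forced_code (Suc m))"
        by (simp only: forced_code_Suc if_True) (simp only: forced_def mem_Collect_eq)
      then show ?thesis unfolding S_def wide_def .
    next
      case False
      then have "S (Suc m) = S m" by (simp add: S lessThan_Suc)
      with Suc show ?thesis by simp
    qed
  qed
  have "\<exists>B. infinite B \<and> (\<forall>m. B \<subseteq> S m) \<and> (\<forall>y\<in>B. P y = B \<inter> {..<y})"
  proof (rule ex_path_through_subtrees)
    show "finite (range (\<lambda>S. c (set_encode S)))"
      by (rule finite_subset[OF _ fin_c]) auto
    show "S (Suc m) \<subseteq> S m" for m unfolding S lessThan_Suc by blast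
    show "S 0 \<subseteq> A" unfolding S by blast
    show "x \<in> S m" if "y \<in> S m" "x \<in> P y" for m x y
    proof -
      have "x \<in> A" using that(2) preds_below_subset by blast
      with that(1) survives_down[OF _ that(2)] show ?thesis unfolding S by blast
    qed
  qed (rule inf_S)
  then obtain B where B1: "infinite B \<and> (\<forall>m. B \<subseteq> S m) \<and> (\<forall>y\<in>B. P y = B \<inter> {..<y})" ..
  then have B: "infinite B" "\<And>m. B \<subseteq> S m" "\<And>y. y \<in> B \<Longrightarrow> P y = B \<inter> {..<y}"
    by (rule conjunct1) (rule B1[THEN conjunct2, THEN conjunct1, rule_format],
      rule B1[THEN conjunct2, THEN conjunct2, rule_format])
  have "B \<subseteq> A" using B(2)[of 0] unfolding S by blast
  have cert: "halting_certificate (oracle_at y) e w \<longleftrightarrow> halting_certificate (join B X) e w"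
    if "y \<in> B" "w < y" for y e w
  proof (rule halting_certificate_cong)
    have "oracle_at y \<inter> {..<y} = join B X \<inter> {..<y}"
      unfolding oracle_at_def B(3)[OF that(1)] by (rule join_agree)
    then show "oracle_at y \<inter> {..<w} = join B X \<inter> {..<w}"
      by (rule agree_below) (use that in simp)
  qed
  have jump: "e \<in> turing_jump (join B X) \<longleftrightarrow> e \<notin> forced" for e
  proof
    assume "e \<in> turing_jump (join B X)"
    then obtain w where w: "halting_certificate (join B X) e w"
      unfolding turing_jump_iff by blast
    obtain y where y: "y \<in> B" "w < y"
      using B(1) unfolding infinite_nat_iff_unbounded by blast
    then have "\<not> survives e y" using w cert unfolding survives_def by blast
    moreover have "y \<in> S (Suc e)" using y B(2) by blast
    ultimately show "e \<notin> forced" unfolding S by blast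
  next
    assume e: "e \<notin> forced"
    then have "finite {y. node (forced_code e + 2 ^ e) y}"
      by (simp add: forced_def wide_def)
    \<comment> \<open>The infinite path cannot lie in a finite subtree. A node of \<open>B\<close>
      outside it still meets all earlier requirements, so it fails the one for \<open>e\<close>, and
      this failure is a halting certificate.\<close>
    with B(1) have "\<not> B \<subseteq> {y. node (forced_code e + 2 ^ e) y}"
      using finite_subset by blast
    then obtain y where y: "y \<in> B" "\<not> node (forced_code e + 2 ^ e) y" by blast
    have "set_decode (2 ^ e + forced_code e) = insert e (set_decode (forced_code e))"
      by (rule set_decode_plus_power_2) (simp only: set_decode_forced_code; simp)
    then have "node (forced_code e + 2 ^ e) y \<longleftrightarrow> survives e y \<and> node (forced_code e) y"
      unfolding node_iff by (simp only: add.commute[of "forced_code e"]) blast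
    moreover have "node (forced_code e) y" using y(1) B(2)[of e] unfolding S_def by blast
    ultimately have "\<not> survives e y" using y(2) by blast
    then show "e \<in> turing_jump (join B X)"
      unfolding turing_jump_iff survives_def using cert y(1) by blast
  qed
  have "turing_jump (join B X) \<le>\<^sub>T turing_jump (turing_jump X)"
    unfolding turing_le_iff_dec jump by (rule dec_not[OF dec_forced])
  moreover have "end_homogeneous c B"
    unfolding end_homogeneous_def
  proof (intro ballI allI impI)
    fix x y T
    assume "x \<in> B" "y \<in> B" and T: "T \<subseteq> B \<inter> {..<x}" and "x < y"
    then have "x \<in> P y" using B(3) by auto
    then have "\<forall>S\<subseteq>preds_below A (\<lambda>S. c (set_encode S)) y x. c (set_encode (insert x S)) = c (set_encode (insert y S))"
      using in_preds_below_iff[OF \<open>x < y\<close>, of A "\<lambda>S. c (set_encode S)" y] by blast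
    moreover have "preds_below A (\<lambda>S. c (set_encode S)) y x = B \<inter> {..<x}"
      using preds_below_coherent[OF \<open>x \<in> P y\<close> order_refl] B(3)[OF \<open>x \<in> B\<close>] by simp
    ultimately show "c (set_encode (insert x T)) = c (set_encode (insert y T))"
      using T by blast
  qed
  ultimately show ?thesis
    using B(1) \<open>B \<subseteq> A\<close> turing_le_join by blast
qed

end


section \<open>Homogeneous sets\<close>

lemma brauer_pattern_eq:
  "{a + i * b |i. i < 3} \<union> {1 * b} = {a, b, a + b, a + 2 * b}" for a b :: nat
proof -
  have "{a + i * b |i. i < 3} = (\<lambda>i. a + i * b) ` {..<3}"
    unfolding image_def lessThan_def by blast
  moreover have "{..<3} = {0, 1, 2 :: nat}"
    by (simp add: numeral_3_eq_3 numeral_2_eq_2 lessThan_Suc insert_commute)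
  ultimately have "{a + i * b |i. i < 3} = {a, a + b, a + 2 * b}"
    by simp
  then show ?thesis by (simp only: mult_1) blast
qed

text \<open>One number with the property makes \<open>brauer_number 2 3 1\<close> an attained
  minimum; for 17 the finitely many patterns can be refuted propositionally.\<close>

lemma brauer_property_17: "brauer_property 2 3 1 17"
  unfolding brauer_property_def
proof
  fix g :: "nat \<Rightarrow> nat"
  assume g: "g \<in> {1..17} \<rightarrow> {..<2}"
  define Q where "Q k \<longleftrightarrow> g k = 0" for k
  show "\<exists>a>0. \<exists>b>0. {a + i * b |i. i < 3} \<union> {1 * b} \<subseteq> {1..17} \<and>
    monochromatic g ({a + i * b |i. i < 3} \<union> {1 * b})"
  proof (rule ccontr)
    assume contr: "\<not> ?thesis"
    have no_mono: "(Q a \<or> Q b \<or> Q (a + b) \<or> Q (a + 2 * b)) \<and>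
        (\<not> Q a \<or> \<not> Q b \<or> \<not> Q (a + b) \<or> \<not> Q (a + 2 * b))"
      if ab: "0 < a" "0 < b" "a + 2 * b \<le> 17" for a b
    proof (rule ccontr)
      assume *: "\<not> ?thesis"
      have sub: "{a, b, a + b, a + 2 * b} \<subseteq> {1..17}"
        using ab by auto
      have two: "g x = 0 \<or> g x = 1" if "x \<in> {a, b, a + b, a + 2 * b}" for x
      proof -
        have "g x \<in> {..<2}" using funcset_mem[OF g subsetD[OF sub that]] .
        then show ?thesis by (simp add: less_2_cases_iff)
      qed
      have "monochromatic g {a, b, a + b, a + 2 * b}"
      proof -
        from * have "(\<forall>x\<in>{a, b, a + b, a + 2 * b}. g x = 0) \<or> (\<forall>x\<in>{a, b, a + b, a + 2 * b}. g x \<noteq> 0)"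
          by (simp only: Q_def ball_simps de_Morgan_conj de_Morgan_disj not_not) blast
        then show ?thesis
        proof
          assume "\<forall>x\<in>{a, b, a + b, a + 2 * b}. g x = 0"
          then show ?thesis unfolding monochromatic_def by (rule exI)
        next
          assume "\<forall>x\<in>{a, b, a + b, a + 2 * b}. g x \<noteq> 0"
          then have "\<forall>x\<in>{a, b, a + b, a + 2 * b}. g x = 1" using two by meson
          then show ?thesis unfolding monochromatic_def by (rule exI)
        qed
      qed
      with sub ab have "\<exists>a>0. \<exists>b>0. {a + i * b |i. i < 3} \<union> {1 * b} \<subseteq> {1..17} \<and>
          monochromatic g ({a + i * b |i. i < 3} \<union> {1 * b})"
        unfolding brauer_pattern_eq by (intro exI[of _ a] exI[of _ b] conjI)
      with contr show False by (rule notE)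
    qed
    \<comment> \<open>Each of these 32 pairs forbids its four numbers to share a color, and together
      they are contradictory as clauses on the truth values \<open>Q k\<close> with
      \<open>k \<le> 17\<close>.\<close>
    show False
      by (insert no_mono[of 1 1] no_mono[of 1 3] no_mono[of 1 4] no_mono[of 1 5] no_mono[of 1 7]
      no_mono[of 2 2] no_mono[of 2 3] no_mono[of 2 5] no_mono[of 2 6] no_mono[of 3 1]
      no_mono[of 3 5] no_mono[of 3 6] no_mono[of 4 3] no_mono[of 4 4] no_mono[of 4 5]
      no_mono[of 5 1] no_mono[of 5 2] no_mono[of 5 4] no_mono[of 5 5] no_mono[of 5 6]
      no_mono[of 6 3] no_mono[of 7 2] no_mono[of 7 3] no_mono[of 7 4] no_mono[of 8 1]
      no_mono[of 8 3] no_mono[of 9 2] no_mono[of 9 3] no_mono[of 9 4] no_mono[of 10 1]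
      no_mono[of 11 2] no_mono[of 12 1],
        simp del: One_nat_def, sat)
  qed
qed

text \<open>
  \<open>d\<close> is the coloring \<open>c\<close> after removing the \<open>j\<close> largest elements of a set.
\<close>

lemma stages:
  assumes c: "computable c" and fin_c: "finite (range c)"
  shows "\<exists>A Y d. infinite A \<and> A \<le>\<^sub>T Y \<and> turing_jump Y \<le>\<^sub>T (turing_jump ^^ Suc j) {} \<and>
     computable_in Y d \<and> finite (range d) \<and>
     (\<forall>S T. finite S \<and> finite T \<and> S \<subseteq> A \<and> T \<subseteq> A \<and> card T = j \<and> (\<forall>s\<in>S. \<forall>t\<in>T. s < t) \<longrightarrow>
        d (set_encode S) = c (set_encode (S \<union> T))) \<and>
     (\<forall>i\<le>j. \<exists>v. \<forall>T. finite T \<and> T \<subseteq> A \<and> card T = i \<longrightarrow> c (set_encode T) = v)"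
proof (induction j)
  case 0
  \<comment> \<open>The witnesses are the set of all numbers, the empty oracle and \<open>c\<close>
    itself; among the sizes up to 0 only the empty set occurs.\<close>
  show ?case
  proof (intro exI conjI allI impI)
    show "infinite (UNIV :: nat set)" by simp
    show "UNIV \<le>\<^sub>T {}" unfolding turing_le_iff_dec by (simp add: dec_const)
    show "turing_jump {} \<le>\<^sub>T (turing_jump ^^ Suc 0) {}" by (simp add: turing_le_refl)
    show "computable_in {} c" using c by (simp add: computable_def)
    show "finite (range c)" by (rule fin_c)
  qed auto
next
  case (Suc j)
  then obtain A Y d where A: "infinite A" "A \<le>\<^sub>T Y"
    and jump_Y: "turing_jump Y \<le>\<^sub>T (turing_jump ^^ Suc j) {}"
    and d: "computable_in Y d" "finite (range d)"
    and dc: "\<And>S T. finite S \<Longrightarrow> finite T \<Longrightarrow> S \<subseteq> A \<Longrightarrow> T \<subseteq> A \<Longrightarrow> card T = j \<Longrightarrow>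
      (\<forall>s\<in>S. \<forall>t\<in>T. s < t) \<Longrightarrow> d (set_encode S) = c (set_encode (S \<union> T))"
    and mono: "\<And>i. i \<le> j \<Longrightarrow> \<exists>v. \<forall>T. finite T \<and> T \<subseteq> A \<and> card T = i \<longrightarrow> c (set_encode T) = v"
    by (elim exE conjE) simp
  from ex_end_homogeneous[OF A(2,1) d] obtain B Z where B: "infinite B" "B \<subseteq> A" "B \<le>\<^sub>T Z"
    and Z: "Y \<le>\<^sub>T Z" "turing_jump Z \<le>\<^sub>T turing_jump (turing_jump Y)"
    and hom: "end_homogeneous d B"
    by (elim exE conjE)
  \<comment> \<open>\<open>s < 2 ^ x\<close> says that \<open>x\<close> exceeds every element of the
    set coded by \<open>s\<close>. By end-homogeneity any such \<open>x\<close> in \<open>B\<close>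
    gives the same color, so the least one may be taken, which is found computably.\<close>
  define x where "x s = (LEAST x. x \<in> B \<and> s < 2 ^ x)" for s :: nat
  have ex: "\<exists>x. x \<in> B \<and> s < 2 ^ x" for s :: nat
  proof -
    obtain x where "x \<in> B" "s < x" using B(1) unfolding infinite_nat_iff_unbounded by blast
    moreover have "x < 2 ^ x" by (rule less_exp)
    ultimately show ?thesis using less_trans by blast
  qed
  have x: "x s \<in> B" "s < 2 ^ x s" for s
    using LeastI_ex[OF ex[of s]] unfolding x_def by simp_all
  define d' where "d' s = d (s + 2 ^ x s)" for s
  have "computable_in Z x"
    unfolding x_def by (intro comp_Least ex comp_intros dec_turing_le[OF B(3)])
  then have comp_d': "computable_in Z d'"
    unfolding d'_def by (intro comp_compose[OF computable_in_mono[OF Z(1) d(1)]] comp_intros)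
  have fin_d': "finite (range d')"
    by (rule finite_subset[OF _ d(2)]) (auto simp: d'_def)
  \<comment> \<open>The jump of \<open>Z\<close> is below the double jump of \<open>Y\<close>, that
    is, below one more jump applied to the bound for the jump of \<open>Y\<close>.\<close>
  have jump_Z: "turing_jump Z \<le>\<^sub>T (turing_jump ^^ Suc (Suc j)) {}"
    using turing_le_trans[OF Z(2) turing_jump_mono[OF jump_Y]] by simp
  have d'c: "d' (set_encode S) = c (set_encode (S \<union> T))"
    if fin: "finite S" "finite T" and sub: "S \<subseteq> B" "T \<subseteq> B" and card: "card T = Suc j"
      and less: "\<forall>s\<in>S. \<forall>t\<in>T. s < t" for S T
  proof -
    \<comment> \<open>The new top \<open>y\<close> of \<open>S\<close> is exchanged for
      \<open>t\<close> by end-homogeneity. The remaining \<open>j\<close> elements of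
      \<open>T\<close> lie above \<open>insert t S\<close>, so the previous stage applies.\<close>
    define t where "t = Min T"
    have "T \<noteq> {}" using card by auto
    then have t: "t \<in> T" "\<And>u. u \<in> T \<Longrightarrow> t \<le> u"
      using fin unfolding t_def by simp_all
    define y where "y = x (set_encode S)"
    have y: "y \<in> B" "set_encode S < 2 ^ y" using x unfolding y_def by simp_all
    have S_y: "S \<subseteq> {..<y}"
    proof
      fix s
      assume "s \<in> S"
      then have "2 ^ s \<le> set_encode S"
        using fin(1) unfolding set_encode_def by (simp add: member_le_sum)
      with y(2) have "(2::nat) ^ s < 2 ^ y" by linarith
      then show "s \<in> {..<y}" by simp
    qed
    have S_t: "S \<subseteq> {..<t}" using less t(1) by auto
    have "y \<notin> S" using S_y by blast
    then have "d' (set_encode S) = d (set_encode (insert y S))"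
      unfolding d'_def y_def[symmetric] using set_encode_insert[OF fin(1), of y]
      by (simp add: add.commute)
    also have "\<dots> = d (set_encode (insert t S))"
    proof -
      have hom': "d (set_encode (insert u S)) = d (set_encode (insert v S))"
        if "u \<in> B" "v \<in> B" "S \<subseteq> {..<u}" "u < v" for u v
        using hom that sub(1) unfolding end_homogeneous_def by blast
      have "t \<in> B" using t(1) sub(2) by blast
      show ?thesis
        using hom'[OF y(1) \<open>t \<in> B\<close> S_y] hom'[OF \<open>t \<in> B\<close> y(1) S_t]
        by (cases t y rule: linorder_cases) simp_all
    qed
    also have "\<dots> = c (set_encode (insert t S \<union> (T - {t})))"
    proof (rule dc)
      show "\<forall>s\<in>insert t S. \<forall>u\<in>T - {t}. s < u"
        using less t(2) by (auto simp: order_less_le)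
      show "card (T - {t}) = j" using card t(1) fin(2) by simp
    qed (use fin sub t(1) B(2) in auto)
    also have "insert t S \<union> (T - {t}) = S \<union> T" using t(1) by blast
    finally show ?thesis .
  qed
  have "\<exists>v. \<forall>T. finite T \<and> T \<subseteq> B \<and> card T = i \<longrightarrow> c (set_encode T) = v" if i: "i \<le> Suc j" for i
  proof (cases "i = Suc j")
    case True
    \<comment> \<open>With the empty set for \<open>S\<close>, nothing remains after removing the
      \<open>Suc j\<close> largest elements, so the color is the same for all
      \<open>T\<close>.\<close>
    have "c (set_encode T) = d' (set_encode {})" if "finite T" "T \<subseteq> B" "card T = i" for T
      using d'c[of "{}" T] that True by simp
    then show ?thesis by blast
  next
    case False
    with i have "i \<le> j" by simp
    from mono[OF this] show ?thesis using B(2) by (meson subset_trans)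
  qed
  note mono' = this
  show ?case
  proof (rule exI[of _ B], rule exI[of _ Z], rule exI[of _ d'], intro conjI)
    show "\<forall>S T. finite S \<and> finite T \<and> S \<subseteq> B \<and> T \<subseteq> B \<and> card T = Suc j \<and> (\<forall>s\<in>S. \<forall>t\<in>T. s < t) \<longrightarrow>
        d' (set_encode S) = c (set_encode (S \<union> T))"
    proof (intro allI impI)
      fix S T
      assume "finite S \<and> finite T \<and> S \<subseteq> B \<and> T \<subseteq> B \<and> card T = Suc j \<and> (\<forall>s\<in>S. \<forall>t\<in>T. s < t)"
      then show "d' (set_encode S) = c (set_encode (S \<union> T))"
        by (elim conjE) (rule d'c)
    qed
    show "\<forall>i\<le>Suc j. \<exists>v. \<forall>T. finite T \<and> T \<subseteq> B \<and> card T = i \<longrightarrow> c (set_encode T) = v"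
      by (intro allI impI) (rule mono')
  qed (fact B(1) B(3) jump_Z comp_d' fin_d')+
qed

text \<open>A nonempty pattern does not fit into an empty interval. Positivity allows the Brauer
  number to be written as \<open>Suc j\<close>, where \<open>j\<close> is the number of
  rounds.\<close>

lemma brauer_property_pos:
  assumes "brauer_property r l s n" "0 < l"
  shows "0 < n"
proof (rule ccontr)
  assume "\<not> 0 < n"
  then have "\<exists>a b. {a + i * b |i. i < l} \<union> {s * b} \<subseteq> ({} :: nat set)"
    using assms(1) unfolding brauer_property_def by force
  then show False by blast
qed

theorem proposition1:
  fixes c :: "nat \<Rightarrow> nat"
  assumes "\<forall>x. c x \<in> {0, 1}"
    and "computable c"
  shows "\<exists>H. infinite H \<and> H \<subseteq> {0<..} \<and> apart H \<and>
           (\<exists>a>0. \<exists>b>0. monochromatic c (FS {a, b, a + b, a + 2 * b} H)) \<and>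
           turing_jump H \<le>\<^sub>T (turing_jump ^^ brauer_number 2 3 1) {}"
proof -
  have brauer: "brauer_property 2 3 1 (brauer_number 2 3 1)"
    unfolding brauer_number_def using brauer_property_17 by (rule LeastI)
  define N where "N = brauer_number 2 3 1"
  have N: "brauer_property 2 3 1 N" using brauer unfolding N_def .
  from brauer_property_pos[OF N] obtain j where j: "N = Suc j"
    by (metis Suc_pred zero_less_numeral)
  have "range c \<subseteq> {0, 1}" using assms(1) by (simp only: image_subset_iff) simp
  then have "finite (range c)" by (rule finite_subset) simp
  from stages[OF assms(2) this, of j] obtain A Y d where A: "infinite A" "A \<le>\<^sub>T Y"
    and jump_Y: "turing_jump Y \<le>\<^sub>T (turing_jump ^^ Suc j) {}"
    and d: "computable_in Y d" "finite (range d)"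
    and dc: "\<And>S T. finite S \<Longrightarrow> finite T \<Longrightarrow> S \<subseteq> A \<Longrightarrow> T \<subseteq> A \<Longrightarrow> card T = j \<Longrightarrow>
      (\<forall>s\<in>S. \<forall>t\<in>T. s < t) \<Longrightarrow> d (set_encode S) = c (set_encode (S \<union> T))"
    and mono: "\<And>i. i \<le> j \<Longrightarrow> \<exists>v. \<forall>T. finite T \<and> T \<subseteq> A \<and> card T = i \<longrightarrow> c (set_encode T) = v"
    by (elim exE conjE) simp
  \<comment> \<open>After \<open>j\<close> rounds \<open>d (2 ^ x)\<close> is the color of
    \<open>{x}\<close> together with any \<open>j\<close> larger elements of \<open>A\<close>.
    Fixing this value settles the last size \<open>Suc j\<close>; being a constant, it leaves
    \<open>B\<close> computable in \<open>Y\<close>.\<close>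
  have "finite ((\<lambda>x. d (2 ^ x)) ` A)"
    by (rule finite_subset[OF _ d(2)]) auto
  from pigeonhole_infinite[OF A(1) this] obtain x0 where "infinite {x \<in> A. d (2 ^ x) = d (2 ^ x0)}"
    by blast
  define B where "B = {x \<in> A. d (2 ^ x) = d (2 ^ x0)}"
  have B: "infinite B" "B \<subseteq> A" unfolding B_def by fact auto
  have B_le: "B \<le>\<^sub>T Y"
    unfolding turing_le_iff_dec B_def mem_Collect_eq
    by (intro comp_intros dec_turing_le[OF A(2)] comp_compose[OF d(1)])
  have top: "c (set_encode T) = d (2 ^ x0)" if T: "finite T" "T \<subseteq> B" "card T = Suc j" for T
  proof -
    have "T \<noteq> {}" using T by auto
    then have t: "Min T \<in> T" "\<And>u. u \<in> T \<Longrightarrow> Min T \<le> u" using T(1) by simp_all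
    have "d (set_encode {Min T}) = c (set_encode ({Min T} \<union> (T - {Min T})))"
    proof (rule dc)
      show "\<forall>s\<in>{Min T}. \<forall>u\<in>T - {Min T}. s < u" using t(2) by (auto simp: order_less_le)
      show "card (T - {Min T}) = j" using t(1) T by simp
    qed (use T t(1) B(2) in auto)
    moreover have "{Min T} \<union> (T - {Min T}) = T" using t(1) by blast
    moreover have "d (2 ^ Min T) = d (2 ^ x0)" using t(1) T(2) unfolding B_def by blast
    ultimately show ?thesis by simp
  qed
  have "\<exists>v. \<forall>T. finite T \<and> T \<subseteq> B \<and> card T = i \<longrightarrow> c (set_encode T) = v" if i: "i \<le> N" for i
  proof (cases "i = N")
    case True
    then show ?thesis using top j by blast
  next
    case False
    with i j have "i \<le> j" by simp
    from mono[OF this] show ?thesis using B(2) by (meson subset_trans)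
  qed
  then have "\<forall>i. \<exists>v. i \<le> N \<longrightarrow> (\<forall>T. finite T \<and> T \<subseteq> B \<and> card T = i \<longrightarrow> c (set_encode T) = v)"
    by blast
  \<comment> \<open>\<open>g\<close> colors cardinalities, and Brauer's theorem is applied to it.
    Since \<open>B\<close> has subsets of every finite size, its values up to \<open>N\<close> are
    values of \<open>c\<close>.\<close>
  from choice[OF this] obtain g where g: "\<And>T. finite T \<Longrightarrow> T \<subseteq> B \<Longrightarrow> card T \<le> N \<Longrightarrow>
      c (set_encode T) = g (card T)" by blast
  have "g i < 2" if "i \<le> N" for i
  proof -
    obtain T where T: "finite T" "card T = i" "T \<subseteq> B"
      using infinite_arbitrarily_large[OF B(1), of i] by blast
    have "c (set_encode T) \<in> {0, 1}" using assms(1) by blast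
    then show ?thesis using g[OF T(1,3)] T(2) that by auto
  qed
  then have "g \<in> {1..N} \<rightarrow> {..<2}" by auto
  with N obtain a b where ab: "0 < a" "0 < b" and sub: "{a, b, a + b, a + 2 * b} \<subseteq> {1..N}"
    and mono_g: "monochromatic g {a, b, a + b, a + 2 * b}"
    unfolding brauer_property_def brauer_pattern_eq by blast
  from mono_g obtain v where v: "\<forall>i\<in>{a, b, a + b, a + 2 * b}. g i = v"
    unfolding monochromatic_def ..
  define H where "H = (\<lambda>t. 2 ^ t :: nat) ` B"
  have inj: "inj_on (\<lambda>t. 2 ^ t :: nat) T" for T by (simp add: inj_on_def)
  have "monochromatic c (FS {a, b, a + b, a + 2 * b} H)"
    unfolding monochromatic_def
  proof (intro exI ballI)
    fix x
    assume "x \<in> FS {a, b, a + b, a + 2 * b} H"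
    then obtain F where F: "finite F" "F \<subseteq> H" "card F \<in> {a, b, a + b, a + 2 * b}" and x: "x = \<Sum>F"
      unfolding FS_def by blast
    from F(2) obtain T where T: "T \<subseteq> B" "F = (\<lambda>t. 2 ^ t) ` T"
      unfolding H_def by (auto simp: subset_image_iff)
    have "finite T" "card F = card T" "x = set_encode T"
      using F(1) T(2) x inj[of T] finite_imageD
      by (auto simp: card_image sum.reindex set_encode_def)
    moreover from this have "card T \<in> {a, b, a + b, a + 2 * b}" using F(3) by simp
    moreover from this sub have "card T \<le> N" by fastforce
    ultimately show "c x = v" using g[of T] T(1) v by simp
  qed
  moreover have "apart H"
  proof -
    have "set_decode (2 ^ t) = {t}" for t
      using set_decode_plus_power_2[of t 0] by simp
    then show ?thesis
      unfolding apart_def H_def lambda_exp_def mu_exp_def by auto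
  qed
  moreover have "infinite H" using B(1) inj unfolding H_def by (simp add: finite_image_iff)
  moreover have "H \<subseteq> {0<..}" unfolding H_def by auto
  moreover have "turing_jump H \<le>\<^sub>T (turing_jump ^^ brauer_number 2 3 1) {}"
  proof -
    \<comment> \<open>The bound \<open>t < x\<close> comes from \<open>t < 2 ^ t\<close> and turns
      membership in \<open>H\<close> into a bounded search over \<open>B\<close>.\<close>
    have "x \<in> H \<longleftrightarrow> (\<exists>t<x. x = 2 ^ t \<and> t \<in> B)" for x
      unfolding H_def by (auto intro: less_exp)
    then have "H \<le>\<^sub>T Y"
      unfolding turing_le_iff_dec by (simp only:) (intro comp_intros dec_turing_le[OF B_le])
    from turing_le_trans[OF turing_jump_mono[OF this] jump_Y] show ?thesis
      using j unfolding N_def by simp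
  qed
  ultimately show ?thesis using ab by blast
qed

end
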